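(* Let $\mathbb{F}_q$ be a finite field of characteristic different from $2$ with $q\equiv 1\pmod 3$, let $\rho\in\mathbb{F}_q$ be a primitive cube root of unity and let $t\in\mathbb{F}_q^*$ be a non-square. There exist exactly $$\frac{q+12-(q\bmod 12)}{12}$$ isomorphism classes (over $\mathbb{F}_q$) of elliptic curves over $\mathbb{F}_q$ with $4$ rational subgroups of order $3$ whose nonzero points are defined over $\mathbb{F}_{q^2}$ but not over $\mathbb{F}_q$. These classes are represented by the curves $y^2=x^3+t^2A\,x+t^3B$ with $$A=-\frac{(9a-1-2\rho)(3a-1-2\rho)(3a-1)(3a+1)}{144},$$ $$B=\frac{(1+9a^2)(9a^2-6a-6\rho a-1)(9a^2-6\rho a-1)}{864},$$ where $a\in\mathbb{F}_q\setminus\{0,\rho/3,(\rho+1)/3\}$; that is, every such curve has the stated property, and every elliptic curve over $\mathbb{F}_q$ with the stated property is isomorphic over $\mathbb{F}_q$ to at least one of them.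
   Context: A subgroup $G\subset E(\overline{\mathbb{F}}_q)$ is called rational (over $\mathbb{F}_q$) if it is stable, as a set, under the $q$-power Frobenius map $(x,y)\mapsto(x^q,y^q)$; its individual points need not be defined over $\mathbb{F}_q$. Here $q \bmod 12$ denotes the remainder in $\{0,\dots,11\}$ of the division of $q$ by $12$. *)

theory Defs
  imports "HOL-Algebra.Algebraic_Closure_Type" "HOL-Number_Theory.Cong" "HOL-Library.Cardinality"
begin

section \<open>Weierstrass curves\<close>

text \<open>The curve \<open>y\<^sup>2 + a\<^sub>1xy + a\<^sub>3y = x\<^sup>3 + a\<^sub>2x\<^sup>2 + a\<^sub>4x + a\<^sub>6\<close>.\<close>

datatype 'a weierstrass =
  Weierstrass (a\<^sub>1: 'a) (a\<^sub>2: 'a) (a\<^sub>3: 'a) (a\<^sub>4: 'a) (a\<^sub>6: 'a)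

definition discriminant :: "'a::comm_ring_1 weierstrass \<Rightarrow> 'a" where
  "discriminant E =
     (let b2 = a\<^sub>1 E ^ 2 + 4 * a\<^sub>2 E;
          b4 = 2 * a\<^sub>4 E + a\<^sub>1 E * a\<^sub>3 E;
          b6 = a\<^sub>3 E ^ 2 + 4 * a\<^sub>6 E;
          b8 = a\<^sub>1 E ^ 2 * a\<^sub>6 E + 4 * a\<^sub>2 E * a\<^sub>6 E - a\<^sub>1 E * a\<^sub>3 E * a\<^sub>4 E
               + a\<^sub>2 E * a\<^sub>3 E ^ 2 - a\<^sub>4 E ^ 2
      in - (b2 ^ 2) * b8 - 8 * b4 ^ 3 - 27 * b6 ^ 2 + 9 * b2 * b4 * b6)"

definition elliptic :: "'a::field weierstrass \<Rightarrow> bool" where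
  "elliptic E \<longleftrightarrow> discriminant E \<noteq> 0"

definition short_weierstrass :: "'a::field \<Rightarrow> 'a \<Rightarrow> 'a weierstrass" where
  "short_weierstrass A B = Weierstrass 0 0 0 A B"

text \<open>\<open>E'\<close> arises from \<open>E\<close> by an admissible change of variables
  \<open>x = u\<^sup>2x' + r\<close>, \<open>y = u\<^sup>3y' + u\<^sup>2sx' + w\<close>, after division of the equation by \<open>u\<^sup>6\<close>.
  These are exactly the isomorphisms over the base field of curves in Weierstrass form
  that fix the point at infinity.\<close>

definition isomorphic :: "'a::field weierstrass \<Rightarrow> 'a weierstrass \<Rightarrow> bool" where
  "isomorphic E E' \<longleftrightarrow> (\<exists>u r s w. u \<noteq> 0 \<and>
     u * a\<^sub>1 E' = a\<^sub>1 E + 2 * s \<and>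
     u ^ 2 * a\<^sub>2 E' = a\<^sub>2 E - s * a\<^sub>1 E + 3 * r - s ^ 2 \<and>
     u ^ 3 * a\<^sub>3 E' = a\<^sub>3 E + r * a\<^sub>1 E + 2 * w \<and>
     u ^ 4 * a\<^sub>4 E' = a\<^sub>4 E - s * a\<^sub>3 E + 2 * r * a\<^sub>2 E - (w + r * s) * a\<^sub>1 E
                      + 3 * r ^ 2 - 2 * s * w \<and>
     u ^ 6 * a\<^sub>6 E' = a\<^sub>6 E + r * a\<^sub>4 E + r ^ 2 * a\<^sub>2 E + r ^ 3 - w * a\<^sub>3 E - w ^ 2
                      - r * w * a\<^sub>1 E)"

section \<open>Points and the group law\<close>

datatype 'a point = Infinity | Affine 'a 'a

fun on_curve :: "'a::field weierstrass \<Rightarrow> 'a point \<Rightarrow> bool" where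
  "on_curve E Infinity \<longleftrightarrow> True"
| "on_curve E (Affine x y) \<longleftrightarrow>
     y ^ 2 + a\<^sub>1 E * x * y + a\<^sub>3 E * y = x ^ 3 + a\<^sub>2 E * x ^ 2 + a\<^sub>4 E * x + a\<^sub>6 E"

text \<open>The chord-tangent law; \<open>l\<close> is the slope of the line through the two points.
  Two points of the curve with the same first coordinate are either opposite, and then their
  sum is \<open>Infinity\<close>, or equal, and then the line is the tangent.\<close>

fun add_point :: "'a::field weierstrass \<Rightarrow> 'a point \<Rightarrow> 'a point \<Rightarrow> 'a point" where
  "add_point E Infinity Q = Q"
| "add_point E P Infinity = P"
| "add_point E (Affine x1 y1) (Affine x2 y2) =
     (if x1 = x2 \<and> y1 + y2 + a\<^sub>1 E * x1 + a\<^sub>3 E = 0 then Infinity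
      else
        let l = (if x1 = x2
                 then (3 * x1 ^ 2 + 2 * a\<^sub>2 E * x1 + a\<^sub>4 E - a\<^sub>1 E * y1)
                        / (2 * y1 + a\<^sub>1 E * x1 + a\<^sub>3 E)
                 else (y2 - y1) / (x2 - x1));
            x3 = l ^ 2 + a\<^sub>1 E * l - a\<^sub>2 E - x1 - x2
        in Affine x3 (- (l * (x3 - x1) + y1) - a\<^sub>1 E * x3 - a\<^sub>3 E))"

definition point_group :: "'a::field weierstrass \<Rightarrow> 'a point monoid" where
  "point_group E =
     \<lparr>carrier = {P. on_curve E P}, monoid.mult = add_point E, one = Infinity\<rparr>"

section \<open>Rationality over a finite field\<close>

text \<open>The finite field with \<open>q\<close> elements is a type \<open>'a\<close> with \<open>q = CARD('a)\<close>, its algebraic closure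
  is \<open>'a alg_closure\<close>.\<close>

definition geometric_group ::
    "'a::{field,finite} weierstrass \<Rightarrow> 'a alg_closure point monoid" where
  "geometric_group E = point_group (map_weierstrass to_ac E)"

definition frobenius_point ::
    "'a::{field,finite} alg_closure point \<Rightarrow> 'a alg_closure point" where
  "frobenius_point = map_point (\<lambda>x. x ^ CARD('a))"

definition rational_set :: "'a::{field,finite} alg_closure point set \<Rightarrow> bool" where
  "rational_set G \<longleftrightarrow> frobenius_point ` G \<subseteq> G"

text \<open>The set of coordinates \<open>set_point P\<close> is empty for \<open>P = Infinity\<close>.\<close>

definition defined_over_base :: "'a::{field,finite} alg_closure point \<Rightarrow> bool" where
  "defined_over_base P \<longleftrightarrow> set_point P \<subseteq> range to_ac"

text \<open>The subfield with \<open>q\<^sup>2\<close> elements of the algebraic closure consists of the roots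
  of \<open>X\<^bsup>q\<^sup>2\<^esup> - X\<close>.\<close>

definition defined_over_quadratic_ext :: "'a::{field,finite} alg_closure point \<Rightarrow> bool" where
  "defined_over_quadratic_ext P \<longleftrightarrow> set_point P \<subseteq> {x. x ^ (CARD('a) ^ 2) = x}"

definition quadratic_order3_subgroups ::
    "'a::{field,finite} weierstrass \<Rightarrow> 'a alg_closure point set set" where
  "quadratic_order3_subgroups E =
     {G. subgroup G (geometric_group E) \<and> card G = 3 \<and> rational_set G \<and>
         (\<forall>P \<in> G - {Infinity}. defined_over_quadratic_ext P \<and> \<not> defined_over_base P)}"

definition four_quadratic_order3_curves :: "'a::{field,finite} weierstrass set" where
  "four_quadratic_order3_curves =
     {E. elliptic E \<and> card (quadratic_order3_subgroups E) = 4}"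

definition isomorphism_classes ::
    "'a::field weierstrass set \<Rightarrow> 'a weierstrass set set" where
  "isomorphism_classes S = S // {(E, E'). isomorphic E E'}"

section \<open>The parametrised family\<close>

definition family_A :: "'a::field \<Rightarrow> 'a \<Rightarrow> 'a" where
  "family_A \<rho> a =
     - ((9 * a - 1 - 2 * \<rho>) * (3 * a - 1 - 2 * \<rho>) * (3 * a - 1) * (3 * a + 1)) / 144"

definition family_B :: "'a::field \<Rightarrow> 'a \<Rightarrow> 'a" where
  "family_B \<rho> a =
     (1 + 9 * a ^ 2) * (9 * a ^ 2 - 6 * a - 6 * \<rho> * a - 1) * (9 * a ^ 2 - 6 * \<rho> * a - 1) / 864"

end

theory Submission
  imports Defs "HOL-Number_Theory.Residues"
begin

text \<open>
  A subgroup of order 3 is \<open>{O, P, -P}\<close> for a flex \<open>P\<close>, so it corresponds to a root \<open>x\<close> of the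
  3-division polynomial. It is rational iff \<open>x\<close> lies in the base field; its points are then
  defined over the quadratic extension, and they are defined over the base field iff
  \<open>(2y + a\<^sub>1x + a\<^sub>3)\<^sup>2\<close>, which is a polynomial in \<open>x\<close>, takes a square value there. Twisting by the
  non-square \<open>t\<close> exchanges squares and non-squares, so up to this twist the curves in question are
  the curves \<open>y\<^sup>2 = x\<^sup>3 + Ax + B\<close> with four rational flexes up to sign.

  Two flexes with tangents \<open>y = L\<^sub>1(x)\<close> and \<open>y = L\<^sub>2(x)\<close> give
  \<open>(x - x\<^sub>1)\<^sup>3 + L\<^sub>1\<^sup>2 = x\<^sup>3 + Ax + B = (x - x\<^sub>2)\<^sup>3 + L\<^sub>2\<^sup>2\<close>. Comparing \<open>(L\<^sub>2 - L\<^sub>1)(L\<^sub>2 + L\<^sub>1)\<close> with the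
  factorisation of \<open>(x - x\<^sub>1)\<^sup>3 - (x - x\<^sub>2)\<^sup>3\<close> by means of \<open>\<rho>\<close> determines the curve from a single
  parameter \<open>a\<close> and a scaling factor \<open>u\<close>.

  Each of the 12 ordered pairs of flexes of a curve of the family arises in this way from
  a parameter in its isomorphism class, and a parameter arises from as many pairs as there are
  values of \<open>u\<^sup>2\<close> with \<open>u\<close> an automorphism: 3 if \<open>A = 0\<close>, at most 2 if \<open>B = 0\<close>, 1 otherwise.
  Hence the classes contain at least 4, 6 and 12 parameters respectively, and by the degrees of \<open>A\<close>,
  \<open>B\<close> and of the \<open>j\<close>-invariant they contain no more. So \<open>q - 3 = 4 + 6j + 12k\<close> with \<open>j \<le> 1\<close>, and there
  are \<open>1 + j + k\<close> classes.
\<close>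

section \<open>Flexes of curves in short form\<close>

lemma numerals_nonzero:
  assumes "(2::'a::field) \<noteq> 0" "(3::'a) \<noteq> 0"
  shows "(4::'a) \<noteq> 0" "(6::'a) \<noteq> 0" "(8::'a) \<noteq> 0" "(9::'a) \<noteq> 0" "(12::'a) \<noteq> 0" "(16::'a) \<noteq> 0"
    "(27::'a) \<noteq> 0" "(36::'a) \<noteq> 0" "(144::'a) \<noteq> 0" "(432::'a) \<noteq> 0" "(864::'a) \<noteq> 0"
proof -
  have *: "2 ^ m * 3 ^ n \<noteq> (0::'a)" for m n
    using assms by simp
  show "(4::'a) \<noteq> 0" "(6::'a) \<noteq> 0" "(8::'a) \<noteq> 0" "(9::'a) \<noteq> 0" "(12::'a) \<noteq> 0" "(16::'a) \<noteq> 0"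
    "(27::'a) \<noteq> 0" "(36::'a) \<noteq> 0" "(144::'a) \<noteq> 0" "(432::'a) \<noteq> 0" "(864::'a) \<noteq> 0"
    using *[of 2 0] *[of 1 1] *[of 3 0] *[of 0 2] *[of 2 1] *[of 4 0] *[of 0 3] *[of 2 2] *[of 4 2] *[of 4 3] *[of 5 3]
    by simp_all
qed

text \<open>The 3-division polynomial of \<open>y^2 = x^3 + A*x + B\<close>.\<close>

definition flex_poly :: "'a::field \<Rightarrow> 'a \<Rightarrow> 'a \<Rightarrow> 'a" where
  "flex_poly A B x = 3 * x ^ 4 + 6 * A * x ^ 2 + 12 * B * x - A ^ 2"

text \<open>First coordinates of the flexes defined over the field itself. At a root of
  \<open>flex_poly\<close> with \<open>y = 0\<close> the derivative \<open>3 * x ^ 2 + A\<close>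
  vanishes too, so that point is singular.\<close>

definition square_flexes :: "'a::field \<Rightarrow> 'a \<Rightarrow> 'a set" where
  "square_flexes A B = {x. flex_poly A B x = 0 \<and> (\<exists>y. y \<noteq> 0 \<and> x ^ 3 + A * x + B = y ^ 2)}"

text \<open>The tangent has slope \<open>m / 2\<close>. The first coordinates of its intersections
  with the curve add up to the square of the slope, so contact of order three means
  \<open>3 * x = (m / 2) ^ 2\<close>.\<close>

lemma flex_poly_tangent:
  assumes "m ^ 2 = 12 * x" "m * y = 3 * x ^ 2 + A" "x ^ 3 + A * x + B = y ^ 2"
  shows "flex_poly A B x = 0"
proof -
  have "A = m * y - 3 * x ^ 2" "B = y ^ 2 - (x ^ 3 + A * x)" "12 * x = m ^ 2"
    by (simp_all add: assms(2) flip: assms(1,3))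
  then show ?thesis
    unfolding flex_poly_def by Groebner_Basis.algebra
qed

lemma square_flex_tangent:
  assumes "x \<in> square_flexes A B"
  obtains m y where "y \<noteq> 0" "m ^ 2 = 12 * x" "m * y = 3 * x ^ 2 + A" "x ^ 3 + A * x + B = y ^ 2"
proof -
  obtain y where y: "y \<noteq> 0" "x ^ 3 + A * x + B = y ^ 2" and f: "flex_poly A B x = 0"
    using assms by (auto simp: square_flexes_def)
  define m where "m = (3 * x ^ 2 + A) / y"
  have m: "m * y = 3 * x ^ 2 + A"
    using y by (simp add: m_def)
  have "m ^ 2 * y ^ 2 = (3 * x ^ 2 + A) ^ 2"
    by (simp add: m flip: power_mult_distrib)
  \<comment> \<open>With \<open>f = x ^ 3 + A * x + B\<close> this is the classical form
    \<open>2 * f * f'' - f' ^ 2\<close> of the 3-division polynomial.\<close>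
  also have "\<dots> = 12 * x * (x ^ 3 + A * x + B) - flex_poly A B x"
    unfolding flex_poly_def by Groebner_Basis.algebra
  also have "\<dots> = 12 * x * y ^ 2"
    using f y(2) by simp
  finally have "m ^ 2 = 12 * x"
    using y(1) by simp
  with that y m show thesis by blast
qed

lemma card_flexes_le:
  assumes "(3::'a::field) \<noteq> 0"
  shows "finite {x::'a. flex_poly A B x = 0}" "card {x. flex_poly A B x = 0} \<le> 4"
proof -
  let ?p = "[:- (A ^ 2), 12 * B, 6 * A, 0, 3:]"
  have "?p \<noteq> 0" and "degree ?p = 4"
    using assms by simp_all
  moreover have "{x. flex_poly A B x = 0} = {x. poly ?p x = 0}"
    unfolding flex_poly_def by (rule Collect_cong) (simp add: algebra_simps power4_eq_xxxx power2_eq_square)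
  ultimately show "finite {x. flex_poly A B x = 0}" "card {x. flex_poly A B x = 0} \<le> 4"
    using poly_roots_finite[of ?p] card_poly_roots_bound[of ?p] by simp_all
qed

lemma square_flexes_subset: "square_flexes A B \<subseteq> {x. flex_poly A B x = 0}"
  by (auto simp: square_flexes_def)

lemma card_power_eq_le:
  assumes "n > 0"
  shows "card {v::'a::idom. v ^ n = c} \<le> n"
proof -
  let ?p = "monom 1 n + [:- c:]"
  have "degree ?p = n"
    using assms degree_add_eq_left[of "[:- c:]" "monom 1 n"] by (simp add: degree_monom_eq)
  moreover from this have "?p \<noteq> 0"
    using assms by force
  moreover have "{v. v ^ n = c} = {v. poly ?p v = 0}"
    by (simp add: poly_monom)
  ultimately show "card {v. v ^ n = c} \<le> n"
    using card_poly_roots_bound[of ?p] by simp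
qed

lemma card_eq_mult_card_image:
  assumes "finite A" "\<And>b. b \<in> f ` A \<Longrightarrow> card {a \<in> A. f a = b} = k"
  shows "card A = k * card (f ` A)"
proof -
  have "card A = (\<Sum>b\<in>f ` A. card {a \<in> A. f a = b})"
    unfolding card_eq_sum by (rule sum.image_gen[OF assms(1)])
  also have "\<dots> = k * card (f ` A)"
    using assms(2) by simp
  finally show ?thesis .
qed

lemma card_distinct_pairs:
  assumes "finite V"
  shows "card {(x, y). x \<in> V \<and> y \<in> V \<and> x \<noteq> y} = card V * (card V - 1)"
proof -
  have "{(x, y). x \<in> V \<and> y \<in> V \<and> x \<noteq> y} = (SIGMA x:V. V - {x})"
    by auto
  then show ?thesis
    using assms by simp
qed

text \<open>The three excluded parameters are the zeros of the discriminant of the family, see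
  \<open>noncusps_iff\<close>.\<close>

definition noncusps :: "'a::field \<Rightarrow> 'a set" where
  "noncusps \<rho> = UNIV - {0, \<rho> / 3, (\<rho> + 1) / 3}"

text \<open>Isomorphisms between short forms are rescalings by \<open>u\<close>. The twist by
  \<open>t\<close> does not affect this relation, so it is left out here.\<close>

definition family_class :: "'a::field \<Rightarrow> 'a \<Rightarrow> 'a set" where
  "family_class \<rho> a = {b \<in> noncusps \<rho>. \<exists>u. u \<noteq> 0 \<and>
     family_A \<rho> a = u ^ 4 * family_A \<rho> b \<and> family_B \<rho> a = u ^ 6 * family_B \<rho> b}"

section \<open>The family in terms of the slopes at its flexes\<close>

context
  fixes \<rho> :: "'a::field"
  assumes rho: "\<rho> ^ 2 + \<rho> + 1 = 0" and two: "(2::'a) \<noteq> 0" and three: "(3::'a) \<noteq> 0"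
begin

text \<open>The number \<open>1 + 2 * \<rho>\<close> is a square root of -3, and the four linear
  factors \<open>m\<close> are, up to sign, twice the slopes at the flexes. That their product gives
  \<open>A\<close> reflects that the roots \<open>m ^ 2 / 12\<close> of \<open>flex_poly\<close>
  have product \<open>- (A ^ 2) / 3\<close>.\<close>

lemma family_A_eq: "144 * family_A \<rho> a =
    (1 + 2 * \<rho>) * ((3*a+1) * (3*a-1) * (3*a-(1+2*\<rho>)) * (3*(1+2*\<rho>)*a+1))"
proof -
  have "144 * family_A \<rho> a = - ((9 * a - 1 - 2 * \<rho>) * (3 * a - 1 - 2 * \<rho>) * (3 * a - 1) * (3 * a + 1))"
    unfolding family_A_def using numerals_nonzero[OF two three] by simp
  also have "\<dots> = (1 + 2 * \<rho>) * ((3*a+1) * (3*a-1) * (3*a-(1+2*\<rho>)) * (3*(1+2*\<rho>)*a+1))"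
    using rho by Groebner_Basis.algebra
  finally show ?thesis .
qed

lemma family_B_eq: "864 * family_B \<rho> a =
    (1 + 9 * a ^ 2) * (9 * a ^ 2 - 6 * a - 6 * \<rho> * a - 1) * (9 * a ^ 2 - 6 * \<rho> * a - 1)"
  unfolding family_B_def using numerals_nonzero[OF two three] by simp

text \<open>A polynomial identity modulo \<open>\<rho> ^ 2 + \<rho> + 1\<close>. It exhibits the
  zeros of the discriminant, each of them triple.\<close>

lemma family_discriminant:
  "144 * (4 * family_A \<rho> a ^ 3 + 27 * family_B \<rho> a ^ 2) =
     - (1 + 2 * \<rho>) * (a * (3 * a - \<rho>) * (3 * a - (\<rho> + 1))) ^ 3"
proof -
  \<comment> \<open>The factor 5184 clears the denominators: \<open>4 * 144 * 5184 = 144 ^ 3\<close>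
    and \<open>144 * 5184 = 864 ^ 2\<close>.\<close>
  have "5184 * (144 * (4 * family_A \<rho> a ^ 3 + 27 * family_B \<rho> a ^ 2)) =
    (144 * family_A \<rho> a) ^ 3 + 27 * (864 * family_B \<rho> a) ^ 2"
    by (simp add: power_mult_distrib algebra_simps)
  also have "\<dots> = 5184 * (- (1 + 2 * \<rho>) * (a * (3 * a - \<rho>) * (3 * a - (\<rho> + 1))) ^ 3)"
    unfolding family_A_eq family_B_eq using rho by Groebner_Basis.algebra
  finally have "(144 * 36) * (144 * (4 * family_A \<rho> a ^ 3 + 27 * family_B \<rho> a ^ 2)) =
    (144 * 36) * (- (1 + 2 * \<rho>) * (a * (3 * a - \<rho>) * (3 * a - (\<rho> + 1))) ^ 3)"
    by (simp only: mult.assoc[symmetric]) simp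
  then show ?thesis
    by (rule mult_left_cancel[THEN iffD1, rotated]) (simp only: mult_eq_0_iff, simp add: numerals_nonzero[OF two three])
qed

text \<open>Up to sign, \<open>m / 2\<close> is the slope of the tangent at the flex with first coordinate \<open>m\<^sup>2 / 12\<close>.\<close>

lemma family_flex:
  assumes mn: "(m, n) \<in> {(3*a+1, (3*a-1) * (3*a-(1+2*\<rho>)) * (3*(1+2*\<rho>)*a+1)),
    (3*a-1, (3*a+1) * (3*a-(1+2*\<rho>)) * (3*(1+2*\<rho>)*a+1)),
    (3*a-(1+2*\<rho>), (3*a+1) * (3*a-1) * (3*(1+2*\<rho>)*a+1)),
    (3*(1+2*\<rho>)*a+1, (3*a+1) * (3*a-1) * (3*a-(1+2*\<rho>)))}"
  defines "x \<equiv> m ^ 2 / 12" and "y \<equiv> (3 * m ^ 3 + (1 + 2 * \<rho>) * n) / 144"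
  shows "flex_poly (family_A \<rho> a) (family_B \<rho> a) x = 0"
    and "x ^ 3 + family_A \<rho> a * x + family_B \<rho> a = y ^ 2"
    and "m * y = 3 * x ^ 2 + family_A \<rho> a"
proof -
  note [simp] = numerals_nonzero[OF two three]
  have X: "12 * x = m ^ 2" and Y: "144 * y = 3 * m ^ 3 + (1 + 2 * \<rho>) * n"
    by (simp_all add: x_def y_def)
  \<comment> \<open>Here \<open>n\<close> is the product of the three factors other than
    \<open>m\<close>. Both coefficients have the same expression in \<open>m\<close> and
    \<open>n\<close> in all four cases, so after \<open>A\<close> and \<open>B\<close> the argument
    is uniform.\<close>
  have A: "144 * family_A \<rho> a = (1 + 2 * \<rho>) * (m * n)"
    unfolding family_A_eq using mn by auto
  have B: "8 * (864 * family_B \<rho> a) = - (m ^ 6 + 2 * (1 + 2 * \<rho>) * (m ^ 3 * n) + n ^ 2)"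
  proof -
    let ?s = "1 + 2 * \<rho>" and ?b = "\<lambda>m n. - (m ^ 6 + 2 * (1 + 2 * \<rho>) * (m ^ 3 * n) + n ^ 2)"
    let ?B = "8 * ((1 + 9 * a ^ 2) * (9 * a ^ 2 - 6 * a - 6 * \<rho> * a - 1) * (9 * a ^ 2 - 6 * \<rho> * a - 1))"
    have "?B = ?b (3*a+1) ((3*a-1) * (3*a-?s) * (3*?s*a+1))"
      using rho by Groebner_Basis.algebra
    moreover have "?B = ?b (3*a-1) ((3*a+1) * (3*a-?s) * (3*?s*a+1))"
      using rho by Groebner_Basis.algebra
    moreover have "?B = ?b (3*a-?s) ((3*a+1) * (3*a-1) * (3*?s*a+1))"
      using rho by Groebner_Basis.algebra
    moreover have "?B = ?b (3*?s*a+1) ((3*a+1) * (3*a-1) * (3*a-?s))"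
      using rho by Groebner_Basis.algebra
    ultimately show ?thesis
      unfolding family_B_eq using mn by blast
  qed
  have "144 * (m * y) = 144 * (3 * x ^ 2 + family_A \<rho> a)"
  proof -
    have "144 * (m * y) = m * (144 * y)" "144 * (3 * x ^ 2 + family_A \<rho> a) = 3 * (12 * x) ^ 2 + 144 * family_A \<rho> a"
      by Groebner_Basis.algebra+
    moreover have "m * (3 * m ^ 3 + (1 + 2 * \<rho>) * n) = 3 * (m ^ 2) ^ 2 + (1 + 2 * \<rho>) * (m * n)"
      by Groebner_Basis.algebra
    ultimately show ?thesis
      unfolding X Y A by simp
  qed
  then show my: "m * y = 3 * x ^ 2 + family_A \<rho> a"
    by (rule mult_left_cancel[THEN iffD1, rotated]) simp
  have "144 * 144 * (x ^ 3 + family_A \<rho> a * x + family_B \<rho> a) =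
    12 * (12 * x) ^ 3 + 12 * (144 * family_A \<rho> a) * (12 * x) + 3 * (8 * (864 * family_B \<rho> a))"
    by (simp add: power_mult_distrib algebra_simps)
  also have "\<dots> = 144 * 144 * y ^ 2"
  proof -
    have "12 * (m ^ 2) ^ 3 + 12 * ((1 + 2 * \<rho>) * (m * n)) * m ^ 2 + 3 * - (m ^ 6 + 2 * (1 + 2 * \<rho>) * (m ^ 3 * n) + n ^ 2)
      = (3 * m ^ 3 + (1 + 2 * \<rho>) * n) ^ 2"
      using rho by Groebner_Basis.algebra
    also have "\<dots> = 144 * 144 * y ^ 2"
      unfolding Y[symmetric] by (simp add: power_mult_distrib)
    finally show ?thesis
      unfolding A B X .
  qed
  finally show f: "x ^ 3 + family_A \<rho> a * x + family_B \<rho> a = y ^ 2"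
    by (rule mult_left_cancel[THEN iffD1, rotated]) (simp only: mult_eq_0_iff, simp)
  show "flex_poly (family_A \<rho> a) (family_B \<rho> a) x = 0"
    using X my f by (intro flex_poly_tangent) auto
qed

section \<open>Recovering the parameter from a pair of flexes\<close>

lemma rho_neq_1: "\<rho> \<noteq> 1"
  using rho three by auto

text \<open>The flexes have tangents \<open>L\<^sub>i\<close> of slope \<open>m\<^sub>i / 2\<close>, and \<open>L\<^sub>2 - L\<^sub>1 = ux + k\<close>. Assumption \<open>or\<close> says that
  the zero of \<open>L\<^sub>2 - L\<^sub>1\<close> is that of \<open>(x - x\<^sub>1) - \<rho>(x - x\<^sub>2)\<close>, and not that of
  \<open>(x - x\<^sub>1) - \<rho>\<^sup>2(x - x\<^sub>2)\<close>.\<close>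

lemma oriented_flex_pair:
  assumes u: "u \<noteq> 0"
    and m: "m1 = - (u * (3*a+1))" "m2 = - (u * (3*a-1))"
    and x: "12 * x1 = m1 ^ 2" "12 * x2 = m2 ^ 2"
    and A: "m1 * y1 = 3 * x1 ^ 2 + A" "m2 * y2 = 3 * x2 ^ 2 + A"
    and B: "x1 ^ 3 + A * x1 + B = y1 ^ 2"
    and k: "2 * k = 2 * y2 - 2 * y1 - (m2 * x2 - m1 * x1)"
    and or: "k * (1 - \<rho>) = u * (\<rho> * x2 - x1)"
  shows "A = u ^ 4 * family_A \<rho> a" "B = u ^ 6 * family_B \<rho> a"
    "x1 = u ^ 2 * ((3*a+1) ^ 2 / 12)" "x2 = u ^ 2 * ((3*a-1) ^ 2 / 12)"
proof -
  note nz [simp] = numerals_nonzero[OF two three]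
  define p r w where "p = 3*a+1" and "r = 3*a-1" and "w = u^3"
  have m': "m1 = - (u * p)" "m2 = - (u * r)"
    by (simp_all add: m p_def r_def)
  have X: "12 * x1 = u^2 * p^2" "12 * x2 = u^2 * r^2"
    by (simp_all add: x m' power_mult_distrib)
  \<comment> \<open>Three equations linear in \<open>y1\<close>, \<open>y2\<close>,
    \<open>k\<close>: \<open>E1\<close> eliminates \<open>A\<close> from the two tangent conditions,
    \<open>E2\<close> is the definition of \<open>k\<close>, and \<open>E3\<close> is the
    orientation.\<close>
  have "u * (48 * (r * y2 - p * y1)) = u * (w * (p^4 - r^4))"
  proof -
    have "u * (48 * (r * y2 - p * y1)) = 48 * (m1 * y1) - 48 * (m2 * y2)"
      unfolding m' by Groebner_Basis.algebra
    also have "\<dots> = (12 * x1)^2 - (12 * x2)^2"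
      unfolding A by Groebner_Basis.algebra
    also have "\<dots> = u * (w * (p^4 - r^4))"
      unfolding X w_def by Groebner_Basis.algebra
    finally show ?thesis .
  qed
  then have E1: "48 * (r * y2 - p * y1) = w * (p^4 - r^4)"
    using u by simp
  have E2: "24 * (y2 - y1) = 24 * k - w * (r^3 - p^3)"
  proof -
    have "24 * (y2 - y1) = 12 * (2 * k) + (m2 * (12 * x2) - m1 * (12 * x1))"
      unfolding k by Groebner_Basis.algebra
    also have "\<dots> = 24 * k - w * (r^3 - p^3)"
      unfolding X m' w_def by Groebner_Basis.algebra
    finally show ?thesis .
  qed
  have E3: "12 * (k * (1 - \<rho>)) = w * (\<rho> * r^2 - p^2)"
  proof -
    have "12 * (k * (1 - \<rho>)) = u * (\<rho> * (12 * x2) - 12 * x1)"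
      unfolding or by Groebner_Basis.algebra
    also have "\<dots> = w * (\<rho> * r^2 - p^2)"
      unfolding X w_def by Groebner_Basis.algebra
    finally show ?thesis .
  qed
  \<comment> \<open>The second coordinate that \<open>family_flex\<close> assigns to the factor
    \<open>p\<close>. The goal is \<open>y1 = - (w * Y)\<close>; the sign comes from
    \<open>m1 = - (u * p)\<close>.\<close>
  define Y where "Y = (3 * p^3 + (1 + 2 * \<rho>) * (r * (3*a-(1+2*\<rho>)) * (3*(1+2*\<rho>)*a+1))) / 144"
  have Y: "144 * Y = 3 * p^3 + (1 + 2 * \<rho>) * (r * (3*a-(1+2*\<rho>)) * (3*(1+2*\<rho>)*a+1))"
    by (simp add: Y_def)
  \<comment> \<open>The combination
    \<open>r * (y2 - y1) - (r * y2 - p * y1) = (p - r) * y1 = 2 * y1\<close> removes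
    \<open>y2\<close>.\<close>
  have "2 * (144 * (1 - \<rho>)) * y1 = 3 * (r * (2 * (1 - \<rho>) * (24 * (y2 - y1))) - (1 - \<rho>) * (48 * (r * y2 - p * y1)))"
    unfolding p_def r_def by Groebner_Basis.algebra
  also have "\<dots> = 3 * (r * (4 * (12 * (k * (1 - \<rho>))) - 2 * (1 - \<rho>) * (w * (r^3 - p^3))) - (1 - \<rho>) * (w * (p^4 - r^4)))"
    unfolding E1 E2 by Groebner_Basis.algebra
  also have "\<dots> = w * (3 * (r * (4 * (\<rho> * r^2 - p^2) - 2 * (1 - \<rho>) * (r^3 - p^3)) - (1 - \<rho>) * (p^4 - r^4)))"
    unfolding E3 by Groebner_Basis.algebra
  also have "3 * (r * (4 * (\<rho> * r^2 - p^2) - 2 * (1 - \<rho>) * (r^3 - p^3)) - (1 - \<rho>) * (p^4 - r^4))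
     = - (2 * (1 - \<rho>) * (144 * Y))"
    unfolding Y unfolding p_def r_def using rho by Groebner_Basis.algebra
  finally have "2 * (144 * (1 - \<rho>)) * y1 = 2 * (144 * (1 - \<rho>)) * (- (w * Y))"
    by (simp add: algebra_simps)
  moreover have "2 * (144 * (1 - \<rho>)) \<noteq> 0"
    unfolding mult_eq_0_iff using two rho_neq_1 by simp
  ultimately have y1: "y1 = - (w * Y)"
    by (metis mult_left_cancel)
  have fl: "((p^2/12) ^ 3 + family_A \<rho> a * (p^2/12) + family_B \<rho> a = Y ^ 2)"
    "p * Y = 3 * (p^2/12) ^ 2 + family_A \<rho> a"
    using family_flex(2,3)[of p "r * (3*a-(1+2*\<rho>)) * (3*(1+2*\<rho>)*a+1)" a]
    by (simp_all add: Y_def p_def r_def)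
  show x1: "x1 = u ^ 2 * ((3*a+1) ^ 2 / 12)" and "x2 = u ^ 2 * ((3*a-1) ^ 2 / 12)"
    using X by (simp_all add: p_def r_def field_simps)
  define z where "z = p^2/12"
  have x1': "x1 = u^2 * z"
    using x1 by (simp add: p_def z_def)
  note fl = fl[folded z_def]
  have "A = m1 * y1 - 3 * x1^2"
    by (simp add: A)
  also have "\<dots> = u^4 * (p * Y - 3 * z ^ 2)"
    unfolding m' y1 x1' w_def by Groebner_Basis.algebra
  finally show A': "A = u ^ 4 * family_A \<rho> a"
    unfolding fl by simp
  have "B = y1^2 - (x1 ^ 3 + A * x1)"
    by (simp flip: B)
  also have "\<dots> = u^6 * (Y ^ 2 - (z ^ 3 + family_A \<rho> a * z))"
    unfolding A' y1 x1' w_def by Groebner_Basis.algebra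
  finally show "B = u ^ 6 * family_B \<rho> a"
    by (simp flip: fl(1))
qed

text \<open>The sign of the second flex is chosen so that \<open>oriented_flex_pair\<close> applies.
  Then half the difference of the doubled slopes is \<open>u\<close>, and their sum is
  \<open>- 6 * u * a\<close>, which is nonzero because \<open>m1 ^ 2\<close> and
  \<open>m2 ^ 2\<close> differ.\<close>

lemma flex_pair:
  assumes x: "x1 \<in> square_flexes A B" "x2 \<in> square_flexes A B" "x1 \<noteq> x2"
  obtains u a where "u \<noteq> 0" "a \<noteq> 0" "A = u ^ 4 * family_A \<rho> a" "B = u ^ 6 * family_B \<rho> a"
    "x1 = u ^ 2 * ((3*a+1) ^ 2 / 12)" "x2 = u ^ 2 * ((3*a-1) ^ 2 / 12)"
proof -
  note pair = that
  note nz [simp] = numerals_nonzero[OF two three]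
  obtain m1 y1 where 1: "m1 ^ 2 = 12 * x1" "m1 * y1 = 3 * x1 ^ 2 + A" "x1 ^ 3 + A * x1 + B = y1 ^ 2"
    using square_flex_tangent[OF x(1)] by metis
  obtain m2 y2 where 2: "m2 ^ 2 = 12 * x2" "m2 * y2 = 3 * x2 ^ 2 + A" "x2 ^ 3 + A * x2 + B = y2 ^ 2"
    using square_flex_tangent[OF x(2)] by metis
  define d where "d = x2 - x1"
  have d0: "d \<noteq> 0"
    using x(3) by (simp add: d_def)
  \<comment> \<open>The first flex stays fixed; \<open>m2\<close>, \<open>y2\<close>,
    \<open>u\<close>, \<open>k\<close> are generalised so that both signs of the second flex can be
    inserted.\<close>
  have *: thesis
    if 2: "m2 ^ 2 = 12 * x2" "m2 * y2 = 3 * x2 ^ 2 + A"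
      and u: "2 * u = m2 - m1" and k: "2 * k = 2 * y2 - 2 * y1 - (m2 * x2 - m1 * x1)"
      and or: "k * (1 - \<rho>) = u * (\<rho> * x2 - x1)" for m2 y2 u k
  proof -
    have "u \<noteq> 0" "m1 + m2 \<noteq> 0"
    proof -
      have "12 * d = 2 * u * (m1 + m2)"
        unfolding u d_def right_diff_distrib 1(1)[symmetric] 2(1)[symmetric] by Groebner_Basis.algebra
      with d0 show "u \<noteq> 0" "m1 + m2 \<noteq> 0" by auto
    qed
    define a where "a = - (m1 + m2) / (6 * u)"
    have au: "6 * (u * a) = - (m1 + m2)"
      using \<open>u \<noteq> 0\<close> by (simp add: a_def field_simps)
    have "2 * m1 = - (6 * (u * a)) - 2 * u" "2 * m2 = - (6 * (u * a)) + 2 * u"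
      unfolding au u by Groebner_Basis.algebra+
    moreover have "- (6 * (u * a)) - 2 * u = 2 * - (u * (3*a+1))" "- (6 * (u * a)) + 2 * u = 2 * - (u * (3*a-1))"
      by Groebner_Basis.algebra+
    ultimately have "2 * m1 = 2 * - (u * (3*a+1))" "2 * m2 = 2 * - (u * (3*a-1))"
      by simp_all
    then have m: "m1 = - (u * (3*a+1))" "m2 = - (u * (3*a-1))"
      using mult_left_cancel[OF two] by blast+
    have "a \<noteq> 0"
      using \<open>m1 + m2 \<noteq> 0\<close> au by auto
    with oriented_flex_pair[OF \<open>u \<noteq> 0\<close> m 1(1)[symmetric] 2(1)[symmetric] 1(2) 2(2) 1(3) k or] \<open>u \<noteq> 0\<close>
    show thesis
      by (rule_tac pair[of u a])
  qed
  \<comment> \<open>\<open>L\<^sub>2 - L\<^sub>1 = ux + k\<close> and \<open>L\<^sub>2 + L\<^sub>1 = sx + n\<close>; replacing the second flex by its negative exchanges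
    the two up to sign.\<close>
  define u s where "u = (m2 - m1) / 2" and "s = (m1 + m2) / 2"
  define k n where "k = y2 - y1 - (m2 * x2 - m1 * x1) / 2" and "n = y1 + y2 - (m1 * x1 + m2 * x2) / 2"
  have u2: "2 * u = m2 - m1" and s2: "2 * s = m1 + m2"
    and k2: "2 * k = 2 * y2 - 2 * y1 - (m2 * x2 - m1 * x1)" and n2: "2 * n = 2 * y1 + 2 * y2 - (m1 * x1 + m2 * x2)"
    using two by (simp_all add: u_def s_def k_def n_def field_simps)
  \<comment> \<open>The facts \<open>us\<close>, \<open>sk\<close>, \<open>kn\<close> compare the
    coefficients in \<open>(u*x + k) * (s*x + n) = (x - x1)^3 - (x - x2)^3\<close>.\<close>
  have us: "u * s = 3 * d"
  proof -
    have "4 * (u * s) = (2 * u) * (2 * s)" by simp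
    also have "\<dots> = m2^2 - m1^2" unfolding u2 s2 by Groebner_Basis.algebra
    also have "\<dots> = 4 * (3 * d)" unfolding 1 2 d_def by simp
    finally show ?thesis by (rule mult_left_cancel[THEN iffD1, rotated]) simp
  qed
  have sk: "s * k + u * n = - 3 * d * (x1 + x2)"
  proof -
    have "4 * (s * k + u * n) = (2 * s) * (2 * k) + (2 * u) * (2 * n)"
      by (simp add: algebra_simps)
    also have "\<dots> = 4 * (m2 * y2) - 4 * (m1 * y1) - 2 * m2^2 * x2 + 2 * m1^2 * x1"
      unfolding u2 s2 k2 n2 by Groebner_Basis.algebra
    also have "\<dots> = 4 * (- 3 * d * (x1 + x2))"
      unfolding 1 2 d_def by Groebner_Basis.algebra
    finally show ?thesis by (rule mult_left_cancel[THEN iffD1, rotated]) simp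
  qed
  have kn: "k * n = d * (x1^2 + x1 * x2 + x2^2)"
  proof -
    have "4 * (k * n) = (2 * k) * (2 * n)" by simp
    also have "\<dots> = 4 * (y2^2 - y1^2) - 4 * (m2 * y2) * x2 + 4 * (m1 * y1) * x1 + m2^2 * x2^2 - m1^2 * x1^2"
      unfolding k2 n2 by Groebner_Basis.algebra
    also have "\<dots> = 4 * (d * (x1^2 + x1 * x2 + x2^2))"
      unfolding 1(1,2) 2(1,2) 1(3)[symmetric] 2(3)[symmetric] d_def by Groebner_Basis.algebra
    finally show ?thesis by (rule mult_left_cancel[THEN iffD1, rotated]) simp
  qed
  \<comment> \<open>The right-hand side of this equation is \<open>u ^ 2\<close> times the value of
    \<open>(x - x1)^3 - (x - x2)^3\<close> at \<open>x = - k / u\<close>, which is a zero; the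
    left-hand side is its factorisation by \<open>\<rho>\<close> and
    \<open>\<rho> ^ 2\<close>.\<close>
  have "d * ((k * (1 - \<rho>) - u * (\<rho> * x2 - x1)) * (k * (1 - \<rho>^2) - u * (\<rho>^2 * x2 - x1)))
    = 3 * d * k^2 + 3 * d * k * u * (x1 + x2) + u^2 * (d * (x1^2 + x1 * x2 + x2^2))"
    using rho by Groebner_Basis.algebra
  also have "\<dots> = (u * s) * k^2 - (- 3 * d * (x1 + x2)) * k * u + u^2 * (k * n)"
    unfolding us kn by Groebner_Basis.algebra
  also have "\<dots> = 0"
    unfolding sk[symmetric] by Groebner_Basis.algebra
  finally consider "k * (1 - \<rho>) = u * (\<rho> * x2 - x1)" | "k * (1 - \<rho>^2) = u * (\<rho>^2 * x2 - x1)"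
    using d0 by auto
  then show thesis
  proof cases
    case 1
    show thesis by (rule *[OF 2(1,2) u2 k2 1])
  next
    case k': 2
    have u0: "u \<noteq> 0" and s0: "s \<noteq> 0"
      using us d0 three by auto
    \<comment> \<open>The linear form \<open>u*x + k\<close> has used up the zero belonging to
      \<open>\<rho> ^ 2\<close>, so the zero belonging to \<open>\<rho>\<close> is that of
      \<open>s*x + n\<close>.\<close>
    have "u * (n * (1 - \<rho>)) = - \<rho> * ((- 3 * d * (x1 + x2)) * (1 - \<rho>^2) - s * (k * (1 - \<rho>^2)))"
      unfolding sk[symmetric] using rho by Groebner_Basis.algebra
    also have "\<dots> = u * (s * (\<rho> * x2 - x1))"
      unfolding k' mult_minus_left us[symmetric] using rho by Groebner_Basis.algebra
    finally have n': "(- n) * (1 - \<rho>) = (- s) * (\<rho> * x2 - x1)"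
      using u0 by simp
    have "2 * (- s) = - m2 - m1" "2 * (- n) = 2 * - y2 - 2 * y1 - (- m2 * x2 - m1 * x1)"
      using s2 n2 by (simp_all add: algebra_simps)
    then show thesis
      using 2 by (intro *[of "- m2" "- y2" "- s" "- n"] n') simp_all
  qed
qed

section \<open>Nonsingular members of the family and their flexes\<close>

lemma noncusps_iff: "a \<in> noncusps \<rho> \<longleftrightarrow> 4 * family_A \<rho> a ^ 3 + 27 * family_B \<rho> a ^ 2 \<noteq> 0"
proof -
  note [simp] = numerals_nonzero[OF two three]
  have "1 + 2 * \<rho> \<noteq> 0"
  proof
    assume "1 + 2 * \<rho> = 0"
    moreover have "(1 + 2 * \<rho>) ^ 2 = 4 * (\<rho> ^ 2 + \<rho> + 1) - 3"
      by Groebner_Basis.algebra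
    ultimately show False
      using rho three by simp
  qed
  then have *: "- (1 + 2 * \<rho>) \<noteq> 0"
    by (metis neg_equal_0_iff_equal)
  have "4 * family_A \<rho> a ^ 3 + 27 * family_B \<rho> a ^ 2 = 0 \<longleftrightarrow>
    144 * (4 * family_A \<rho> a ^ 3 + 27 * family_B \<rho> a ^ 2) = 0"
    unfolding mult_eq_0_iff by simp
  also have "\<dots> \<longleftrightarrow> a = 0 \<or> 3 * a - \<rho> = 0 \<or> 3 * a - (\<rho> + 1) = 0"
    unfolding family_discriminant
    by (simp only: mult_eq_0_iff * power_eq_0_iff simp_thms) simp
  also have "\<dots> \<longleftrightarrow> a \<notin> noncusps \<rho>"
    using three by (auto simp: noncusps_def field_simps)
  finally show ?thesis by blast
qed

text \<open>The four factors \<open>m\<close> yield four flexes \<open>m ^ 2 / 12\<close>: any two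
  of the squares differ by a product of nonzero constants and factors of the discriminant.\<close>

lemma card_family_square_flexes:
  assumes a: "a \<in> noncusps \<rho>"
  shows "card (square_flexes (family_A \<rho> a) (family_B \<rho> a)) = 4"
proof (rule antisym)
  note [simp] = numerals_nonzero[OF two three]
  define M where "M = {3*a+1, 3*a-1, 3*a-(1+2*\<rho>), 3*(1+2*\<rho>)*a+1}"
  have sub: "(\<lambda>m. m ^ 2 / 12) ` M \<subseteq> square_flexes (family_A \<rho> a) (family_B \<rho> a)"
  proof (intro image_subsetI)
    fix m assume "m \<in> M"
    then obtain n where n: "(m, n) \<in> {(3*a+1, (3*a-1) * (3*a-(1+2*\<rho>)) * (3*(1+2*\<rho>)*a+1)),
    (3*a-1, (3*a+1) * (3*a-(1+2*\<rho>)) * (3*(1+2*\<rho>)*a+1)),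
    (3*a-(1+2*\<rho>), (3*a+1) * (3*a-1) * (3*(1+2*\<rho>)*a+1)),
    (3*(1+2*\<rho>)*a+1, (3*a+1) * (3*a-1) * (3*a-(1+2*\<rho>)))}"
      unfolding M_def by blast
    note fl = family_flex[OF n]
    \<comment> \<open>A flex with second coordinate zero would give \<open>A = - 3 * x ^ 2\<close>
      and \<open>B = 2 * x ^ 3\<close>, which makes the discriminant vanish.\<close>
    have False if "(3 * m ^ 3 + (1 + 2 * \<rho>) * n) / 144 = 0"
    proof -
      have A: "family_A \<rho> a = - (3 * (m ^ 2 / 12) ^ 2)"
        using fl(3) unfolding that by (simp add: eq_neg_iff_add_eq_0 add.commute)
      have "family_B \<rho> a = - ((m ^ 2 / 12) ^ 3 + family_A \<rho> a * (m ^ 2 / 12))"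
        by (rule minus_unique[symmetric]) (use fl(2) in \<open>simp add: that\<close>)
      then have "family_B \<rho> a = 2 * (m ^ 2 / 12) ^ 3"
        unfolding A by (simp add: power3_eq_cube power2_eq_square)
      with A have "4 * family_A \<rho> a ^ 3 + 27 * family_B \<rho> a ^ 2 = 0"
        by (simp add: power_mult_distrib flip: power_mult)
      with a show False
        by (simp add: noncusps_iff)
    qed
    with fl(1,2) show "m ^ 2 / 12 \<in> square_flexes (family_A \<rho> a) (family_B \<rho> a)"
      unfolding square_flexes_def by blast
  qed
  have fin: "finite (square_flexes (family_A \<rho> a) (family_B \<rho> a))"
    using card_flexes_le(1)[OF three] square_flexes_subset by (rule finite_subset[rotated])
  have nz: "a \<noteq> 0" "3 * a - \<rho> \<noteq> 0" "3 * a - (\<rho> + 1) \<noteq> 0" "\<rho> \<noteq> 0"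
    using a three rho by (auto simp: noncusps_def field_simps)
  have neq: "x^2 / 12 \<noteq> y^2 / 12" if "x^2 - y^2 = c" "c \<noteq> 0" for x y c :: 'a
    using that by auto
  have "(3*a+1)^2 / 12 \<noteq> (3*a-1)^2 / 12"
    by (rule neq[where c = "12 * a"]) (Groebner_Basis.algebra, use nz in \<open>simp only: mult_eq_0_iff; simp\<close>)
  moreover have "(3*a+1)^2 / 12 \<noteq> (3*a-(1+2*\<rho>))^2 / 12"
    by (rule neq[where c = "4 * ((\<rho> + 1) * (3 * a - \<rho>))"]) 
      (Groebner_Basis.algebra, use nz rho in \<open>simp only: mult_eq_0_iff; auto simp: add_eq_0_iff2\<close>)
  moreover have "(3*a-1)^2 / 12 \<noteq> (3*a-(1+2*\<rho>))^2 / 12"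
    by (rule neq[where c = "4 * (\<rho> * (3 * a - (\<rho> + 1)))"])
      (Groebner_Basis.algebra, use nz in \<open>simp only: mult_eq_0_iff; simp\<close>)
  moreover have "(3*a+1)^2 / 12 \<noteq> (3*(1+2*\<rho>)*a+1)^2 / 12"
    by (rule neq[where c = "12 * (a * (3 * a - \<rho>))"])
      (use rho in Groebner_Basis.algebra, use nz in \<open>simp only: mult_eq_0_iff; simp\<close>)
  moreover have "(3*a-1)^2 / 12 \<noteq> (3*(1+2*\<rho>)*a+1)^2 / 12"
    by (rule neq[where c = "12 * (a * (3 * a - (\<rho> + 1)))"])
      (use rho in Groebner_Basis.algebra, use nz in \<open>simp only: mult_eq_0_iff; simp\<close>)
  moreover have "(3*a-(1+2*\<rho>))^2 / 12 \<noteq> (3*(1+2*\<rho>)*a+1)^2 / 12"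
    by (rule neq[where c = "4 * ((3 * a - \<rho>) * (3 * a - (\<rho> + 1)))"])
      (use rho in Groebner_Basis.algebra, use nz in \<open>simp only: mult_eq_0_iff; simp\<close>)
  ultimately have "card ((\<lambda>m. m ^ 2 / 12) ` M) = 4"
    unfolding M_def image_insert image_empty by (simp only: card_insert_disjoint finite.intros insert_iff empty_iff simp_thms) simp
  with card_mono[OF fin sub] show "4 \<le> card (square_flexes (family_A \<rho> a) (family_B \<rho> a))"
    by simp
  show "card (square_flexes (family_A \<rho> a) (family_B \<rho> a)) \<le> 4"
    using card_mono[OF card_flexes_le(1)[OF three] square_flexes_subset, of "family_A \<rho> a" "family_B \<rho> a"]
      card_flexes_le(2)[OF three, of "family_A \<rho> a" "family_B \<rho> a"] by (rule order_trans)
qed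

section \<open>Counting the parameters in an isomorphism class\<close>

lemma third_noncusp: "1 / 3 \<in> noncusps \<rho>" "family_A \<rho> (1 / 3) = 0" "family_B \<rho> (1 / 3) \<noteq> 0"
proof -
  have "\<rho> \<noteq> 0" "\<rho> \<noteq> 1"
    using rho three by auto
  then show 1: "1 / 3 \<in> noncusps \<rho>"
    using three by (simp add: noncusps_def)
  show A: "family_A \<rho> (1 / 3) = 0"
    using three by (simp add: family_A_def)
  show "family_B \<rho> (1 / 3) \<noteq> 0"
    using 1 A by (auto simp: noncusps_iff)
qed

text \<open>Degrees of polynomials in \<open>a\<close>. The third set consists of the parameters
  whose curve has the \<open>j\<close>-invariant belonging to the coefficients \<open>A\<close>,
  \<open>B\<close>.\<close>

lemma family_roots:
  shows "card {a. family_A \<rho> a = 0} \<le> 4"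
    and "card {a. family_B \<rho> a = 0} \<le> 6"
    and "A \<noteq> 0 \<Longrightarrow> card {a. family_A \<rho> a ^ 3 * B ^ 2 = A ^ 3 * family_B \<rho> a ^ 2} \<le> 12"
proof -
  note [simp] = numerals_nonzero[OF two three]
  define p where "p = [:- 1 - 2 * \<rho>, 9:] * [:- 1 - 2 * \<rho>, 3:] * [:- 1, 3:] * [:1, 3:]"
  define r where "r = [:1, 0, 9:] * [:- 1, - 6 - 6 * \<rho>, 9:] * [:- 1, - 6 * \<rho>, 9:]"
  have p: "family_A \<rho> a = - poly p a / 144" for a
    by (simp add: family_A_def p_def algebra_simps)
  have r: "family_B \<rho> a = poly r a / 864" for a
    by (simp add: family_B_def r_def algebra_simps power2_eq_square)
  have p0: "p \<noteq> 0" and r0: "r \<noteq> 0"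
    unfolding p_def r_def mult_eq_0_iff using three by simp_all
  have dp: "Polynomial.degree p \<le> 4" and dr: "Polynomial.degree r \<le> 6"
    unfolding p_def r_def by (intro order_trans[OF degree_mult_le], simp)+
  have A0: "family_A \<rho> a = 0 \<longleftrightarrow> poly p a = 0" and B0: "family_B \<rho> a = 0 \<longleftrightarrow> poly r a = 0" for a
    by (simp_all add: p r)
  show "card {a. family_A \<rho> a = 0} \<le> 4"
    unfolding A0 using card_poly_roots_bound[OF p0] dp by linarith
  show "card {a. family_B \<rho> a = 0} \<le> 6"
    unfolding B0 using card_poly_roots_bound[OF r0] dr by linarith
  assume A: "A \<noteq> 0"
  let ?P = "smult (- (B ^ 2) / 144 ^ 3) (p ^ 3) - smult (A ^ 3 / 864 ^ 2) (r ^ 2)"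
  have P: "poly ?P a = family_A \<rho> a ^ 3 * B ^ 2 - A ^ 3 * family_B \<rho> a ^ 2" for a
    unfolding p r by (simp add: power_divide)
  \<comment> \<open>At \<open>1 / 3\<close> the first term vanishes with \<open>family_A\<close>
    while the second does not, so the polynomial is nonzero.\<close>
  have "poly ?P (1 / 3) \<noteq> 0"
    unfolding P using A third_noncusp(2,3) by simp
  then have P0: "?P \<noteq> 0"
    by (metis poly_0)
  have "Polynomial.degree (p ^ 3) \<le> 12" "Polynomial.degree (r ^ 2) \<le> 12"
    using degree_power_le[of p 3] degree_power_le[of r 2] dp dr by linarith+
  then have dP: "Polynomial.degree ?P \<le> 12"
    by (intro degree_diff_le order_trans[OF degree_smult_le])
  have *: "{a. family_A \<rho> a ^ 3 * B ^ 2 = A ^ 3 * family_B \<rho> a ^ 2} = {a. poly ?P a = 0}"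
    unfolding P by simp
  show "card {a. family_A \<rho> a ^ 3 * B ^ 2 = A ^ 3 * family_B \<rho> a ^ 2} \<le> 12"
    unfolding * using card_poly_roots_bound[OF P0] dP by linarith
qed

lemma full_flexes_family:
  assumes "4 * A ^ 3 + 27 * B ^ 2 \<noteq> 0" and "x1 \<in> square_flexes A B" "x2 \<in> square_flexes A B" "x1 \<noteq> x2"
  obtains u a where "u \<noteq> 0" "a \<in> noncusps \<rho>" "A = u ^ 4 * family_A \<rho> a" "B = u ^ 6 * family_B \<rho> a"
    "x1 = u ^ 2 * ((3*a+1) ^ 2 / 12)" "x2 = u ^ 2 * ((3*a-1) ^ 2 / 12)"
proof -
  obtain u a where ua: "u \<noteq> 0" "A = u ^ 4 * family_A \<rho> a" "B = u ^ 6 * family_B \<rho> a"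
    "x1 = u ^ 2 * ((3*a+1) ^ 2 / 12)" "x2 = u ^ 2 * ((3*a-1) ^ 2 / 12)"
    using flex_pair[OF assms(2-4)] by metis
  have "4 * A ^ 3 + 27 * B ^ 2 = u ^ 12 * (4 * family_A \<rho> a ^ 3 + 27 * family_B \<rho> a ^ 2)"
    unfolding ua(2,3) by Groebner_Basis.algebra
  with assms(1) have "a \<in> noncusps \<rho>"
    by (auto simp: noncusps_iff)
  with ua that show thesis by blast
qed

text \<open>In the assumption on \<open>k\<close>, the variable \<open>v\<close> stands for \<open>u\<^sup>2\<close>: for a fixed parameter \<open>b\<close> the
  pair of flexes that gives rise to \<open>b\<close> depends on \<open>v\<close> only.\<close>

lemma card_family_class_ge:
  fixes a :: 'a
  defines "A \<equiv> family_A \<rho> a" and "B \<equiv> family_B \<rho> a"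
  assumes a: "a \<in> noncusps \<rho>" and fin: "finite (family_class \<rho> a)"
    and k: "\<And>A' B'. \<exists>V::'a set. {v. v ^ 2 * A' = A \<and> v ^ 3 * B' = B} \<subseteq> V \<and> finite V \<and> card V \<le> k"
  shows "12 \<le> card (family_class \<rho> a) * k"
proof -
  define P where "P = {(x, y). x \<in> square_flexes A B \<and> y \<in> square_flexes A B \<and> x \<noteq> y}"
  define V where "V b = {v. v ^ 2 * family_A \<rho> b = A \<and> v ^ 3 * family_B \<rho> b = B}" for b
  define Q where "Q b = (\<lambda>v. (v * ((3*b+1) ^ 2 / 12), v * ((3*b-1) ^ 2 / 12))) ` V b" for b
  have V: "finite (V b)" "card (V b) \<le> k" for b
    using k[of "family_A \<rho> b" "family_B \<rho> b"] unfolding V_def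
    by (meson finite_subset, meson card_mono order_trans)
  have "finite (square_flexes A B)"
    using card_flexes_le(1)[OF three] square_flexes_subset by (rule finite_subset[rotated])
  then have "card P = 12"
    using card_family_square_flexes[OF a] unfolding P_def A_def B_def
    by (simp add: card_distinct_pairs)
  moreover have "P \<subseteq> (\<Union>b\<in>family_class \<rho> a. Q b)"
  proof (clarsimp simp: P_def)
    fix x y assume "x \<in> square_flexes A B" "y \<in> square_flexes A B" "x \<noteq> y"
    moreover have "4 * A ^ 3 + 27 * B ^ 2 \<noteq> 0"
      using a unfolding A_def B_def noncusps_iff .
    ultimately obtain u b where b: "u \<noteq> 0" "b \<in> noncusps \<rho>"
      "A = u ^ 4 * family_A \<rho> b" "B = u ^ 6 * family_B \<rho> b"
      "x = u ^ 2 * ((3*b+1) ^ 2 / 12)" "y = u ^ 2 * ((3*b-1) ^ 2 / 12)"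
      using full_flexes_family[of A B x y thesis] by metis
    have "u ^ 2 \<in> V b"
      unfolding V_def using b(3,4) by (simp flip: power_mult)
    then have "(x, y) \<in> Q b"
      unfolding Q_def b(5,6) by (rule imageI)
    moreover have "b \<in> family_class \<rho> a"
      using b(1-4) unfolding family_class_def A_def B_def by blast
    ultimately show "\<exists>b\<in>family_class \<rho> a. (x, y) \<in> Q b" by blast
  qed
  moreover have "finite (\<Union>b\<in>family_class \<rho> a. Q b)"
    using fin V by (simp add: Q_def)
  ultimately have "12 \<le> card (\<Union>b\<in>family_class \<rho> a. Q b)"
    by (metis card_mono)
  also have "\<dots> \<le> (\<Sum>b\<in>family_class \<rho> a. card (Q b))"
    using fin by (rule card_UN_le)
  also have "\<dots> \<le> (\<Sum>b\<in>family_class \<rho> a. k)"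
    unfolding Q_def by (intro sum_mono order_trans[OF card_image_le V(2)] V(1))
  finally show ?thesis by simp
qed

text \<open>Pairs of flexes give the lower bounds 12/3, 12/2 and 12/1, and the degrees in
  \<open>family_roots\<close> give the matching upper bounds.\<close>

lemma card_family_class:
  assumes a: "a \<in> noncusps \<rho>" and fin: "finite (UNIV :: 'a set)"
  shows "card (family_class \<rho> a) =
    (if family_A \<rho> a = 0 then 4 else if family_B \<rho> a = 0 then 6 else 12)"
proof -
  define A B where "A = family_A \<rho> a" and "B = family_B \<rho> a"
  have fin': "finite T" for T :: "'a set"
    using fin by (rule rev_finite_subset) simp
  note ge = card_family_class_ge[OF a fin', folded A_def B_def]
  have cl: "\<exists>u. u \<noteq> 0 \<and> A = u ^ 4 * family_A \<rho> b \<and> B = u ^ 6 * family_B \<rho> b" if "b \<in> family_class \<rho> a" for b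
    using that by (auto simp: family_class_def A_def B_def)
  consider "A = 0" | "A \<noteq> 0" "B = 0" | "A \<noteq> 0" "B \<noteq> 0" by blast
  then show ?thesis
  proof cases
    case 1
    then have "B \<noteq> 0"
      using a by (auto simp: noncusps_iff A_def B_def)
    have "12 \<le> card (family_class \<rho> a) * 3"
    proof (rule ge, intro exI conjI)
      fix A' B'
      \<comment> \<open>For \<open>B' = 0\<close> the left-hand set is empty because
        \<open>B\<close> is nonzero, so the value of \<open>B / 0\<close> is harmless.\<close>
      show "{v. v ^ 2 * A' = A \<and> v ^ 3 * B' = B} \<subseteq> {v. v ^ 3 = B / B'}"
        using \<open>B \<noteq> 0\<close> by (auto simp: eq_divide_eq)
      show "card {v. v ^ 3 = B / B'} \<le> 3"
        by (rule card_power_eq_le) simp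
    qed (rule fin')
    moreover have "family_class \<rho> a \<subseteq> {b. family_A \<rho> b = 0}"
      using cl 1 by force
    then have "card (family_class \<rho> a) \<le> 4"
      using card_mono[OF fin'] family_roots(1) by (meson order_trans)
    ultimately show ?thesis
      using 1 unfolding A_def[symmetric] by simp
  next
    case 2
    have "12 \<le> card (family_class \<rho> a) * 2"
    proof (rule ge, intro exI conjI)
      fix A' B'
      show "{v. v ^ 2 * A' = A \<and> v ^ 3 * B' = B} \<subseteq> {v. v ^ 2 = A / A'}"
        using 2 by (auto simp: eq_divide_eq)
      show "card {v. v ^ 2 = A / A'} \<le> 2"
        by (rule card_power_eq_le) simp
    qed (rule fin')
    moreover have "family_class \<rho> a \<subseteq> {b. family_B \<rho> b = 0}"
      using cl 2 by force
    then have "card (family_class \<rho> a) \<le> 6"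
      using card_mono[OF fin'] family_roots(2) by (meson order_trans)
    ultimately show ?thesis
      using 2 unfolding A_def[symmetric] B_def[symmetric] by simp
  next
    case 3
    have "12 \<le> card (family_class \<rho> a) * 1"
    proof (rule ge, intro exI conjI)
      fix A' B'
      \<comment> \<open>The only candidate is \<open>v = v ^ 3 / v ^ 2\<close>. The left-hand set is
        empty if \<open>A'\<close> or \<open>B'\<close> is zero.\<close>
      show "{v. v ^ 2 * A' = A \<and> v ^ 3 * B' = B} \<subseteq> {(B / B') / (A / A')}"
        using 3 by (auto simp: power2_eq_square power3_eq_cube)
      show "card {(B / B') / (A / A')} \<le> 1"
        by simp
    qed (rule fin')
    moreover have "family_class \<rho> a \<subseteq> {b. family_A \<rho> b ^ 3 * B ^ 2 = A ^ 3 * family_B \<rho> b ^ 2}"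
    proof
      fix b assume "b \<in> family_class \<rho> a"
      then obtain u where "A = u ^ 4 * family_A \<rho> b" "B = u ^ 6 * family_B \<rho> b"
        using cl by blast
      then show "b \<in> {b. family_A \<rho> b ^ 3 * B ^ 2 = A ^ 3 * family_B \<rho> b ^ 2}"
        by (simp add: power_mult_distrib flip: power_mult)
    qed
    then have "card (family_class \<rho> a) \<le> 12"
      using card_mono[OF fin'] family_roots(3)[OF 3(1)] by (meson order_trans)
    ultimately show ?thesis
      using 3 unfolding A_def[symmetric] B_def[symmetric] by simp
  qed
qed

text \<open>Here \<open>f\<close> is a classifying map for isomorphism. Classes with
  \<open>A = 0\<close> or \<open>B = 0\<close> exhaust the 4 or 6 possible roots, so there is at
  most one of each kind; \<open>j\<close> and \<open>k\<close> count the classes with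
  \<open>B = 0\<close> and the generic ones.\<close>

lemma card_image_family:
  fixes f :: "'a \<Rightarrow> 'b"
  assumes fin: "finite (UNIV :: 'a set)"
    and f: "\<And>a b. a \<in> noncusps \<rho> \<Longrightarrow> b \<in> noncusps \<rho> \<Longrightarrow> f b = f a \<longleftrightarrow> b \<in> family_class \<rho> a"
  obtains j k where "card (f ` noncusps \<rho>) = 1 + j + k" "j \<le> 1" "card (noncusps \<rho>) = 4 + 6 * j + 12 * k"
proof -
  define SA where "SA = {a \<in> noncusps \<rho>. family_A \<rho> a = 0}"
  define SB where "SB = {a \<in> noncusps \<rho>. family_A \<rho> a \<noteq> 0 \<and> family_B \<rho> a = 0}"
  define SC where "SC = {a \<in> noncusps \<rho>. family_A \<rho> a \<noteq> 0 \<and> family_B \<rho> a \<noteq> 0}"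
  have fin': "finite T" for T :: "'a set"
    using fin by (rule rev_finite_subset) simp
  have cong: "family_A \<rho> b = 0 \<longleftrightarrow> family_A \<rho> a = 0" "family_B \<rho> b = 0 \<longleftrightarrow> family_B \<rho> a = 0"
    if "a \<in> noncusps \<rho>" "b \<in> noncusps \<rho>" "f b = f a" for a b
    using f[of a b] that by (auto simp: family_class_def)
  have fibre: "{b \<in> S. f b = f a} = family_class \<rho> a"
    if "S \<in> {SA, SB, SC}" "a \<in> S" for S a
  proof -
    have a: "a \<in> noncusps \<rho>"
      using that by (auto simp: SA_def SB_def SC_def)
    have "{b \<in> S. f b = f a} = {b \<in> noncusps \<rho>. f b = f a}"
      using that cong[OF a] by (auto simp: SA_def SB_def SC_def)
    also have "\<dots> = family_class \<rho> a"
      using f[OF a] by (auto simp: family_class_def)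
    finally show ?thesis .
  qed
  have card_S: "card S = n * card (f ` S)"
    if "S \<in> {SA, SB, SC}" "\<And>a. a \<in> S \<Longrightarrow> card (family_class \<rho> a) = n" for S n
  proof (rule card_eq_mult_card_image[OF fin'])
    fix c assume "c \<in> f ` S"
    then obtain a where "a \<in> S" "c = f a"
      by blast
    then show "card {b \<in> S. f b = c} = n"
      using fibre[OF that(1)] that(2) by simp
  qed
  have A: "card SA = 4 * card (f ` SA)"
    by (rule card_S) (auto simp: SA_def card_family_class[OF _ fin])
  have B: "card SB = 6 * card (f ` SB)"
    by (rule card_S) (auto simp: SB_def card_family_class[OF _ fin])
  have C: "card SC = 12 * card (f ` SC)"
    by (rule card_S) (auto simp: SC_def card_family_class[OF _ fin])
  have "card SA \<le> 4"
    by (rule order_trans[OF card_mono[OF fin'] family_roots(1)]) (auto simp: SA_def)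
  \<comment> \<open>The parameter \<open>1 / 3\<close> makes the class with \<open>A = 0\<close>
    occur for every field in question.\<close>
  moreover have "f ` SA \<noteq> {}"
    using third_noncusp by (auto simp: SA_def)
  then have "card (f ` SA) \<noteq> 0"
    using fin' by simp
  ultimately have nA: "card (f ` SA) = 1"
    using A by linarith
  have "card SB \<le> 6"
    by (rule order_trans[OF card_mono[OF fin'] family_roots(2)]) (auto simp: SB_def)
  then have nB: "card (f ` SB) \<le> 1"
    using B by linarith
  have un: "noncusps \<rho> = SA \<union> (SB \<union> SC)"
    by (auto simp: SA_def SB_def SC_def)
  have "SA \<inter> (SB \<union> SC) = {}" "SB \<inter> SC = {}"
    by (auto simp: SA_def SB_def SC_def)
  then have "card (noncusps \<rho>) = card SA + (card SB + card SC)"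
    unfolding un using fin' by (simp add: card_Un_disjoint)
  moreover have "card (f ` noncusps \<rho>) = card (f ` SA) + (card (f ` SB) + card (f ` SC))"
  proof -
    have "f a \<noteq> f b" if "a \<in> SA" "b \<in> SB \<union> SC" for a b
      using that cong[of b a] by (auto simp: SA_def SB_def SC_def)
    moreover have "f a \<noteq> f b" if "a \<in> SB" "b \<in> SC" for a b
      using that cong[of b a] by (auto simp: SB_def SC_def)
    ultimately have "f ` SA \<inter> (f ` SB \<union> f ` SC) = {}" "f ` SB \<inter> f ` SC = {}"
      by blast+
    then show ?thesis
      unfolding un image_Un using fin' by (simp add: card_Un_disjoint)
  qed
  ultimately show thesis
    using A B C nA nB that[of "card (f ` SB)" "card (f ` SC)"] by simp
qed

end

section \<open>Isomorphisms and division polynomials\<close>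

text \<open>The usual quantities \<open>b2\<close>, \<open>b4\<close>, \<open>b6\<close>,
  \<open>b8\<close>. Under a change of variables they depend on \<open>u\<close> and
  \<open>r\<close> only, not on \<open>s\<close> and \<open>w\<close>.\<close>

definition b_invs :: "'a::comm_ring_1 weierstrass \<Rightarrow> 'a \<times> 'a \<times> 'a \<times> 'a" where
  "b_invs E = (a\<^sub>1 E ^ 2 + 4 * a\<^sub>2 E, 2 * a\<^sub>4 E + a\<^sub>1 E * a\<^sub>3 E, a\<^sub>3 E ^ 2 + 4 * a\<^sub>6 E,
     a\<^sub>1 E ^ 2 * a\<^sub>6 E + 4 * a\<^sub>2 E * a\<^sub>6 E - a\<^sub>1 E * a\<^sub>3 E * a\<^sub>4 E + a\<^sub>2 E * a\<^sub>3 E ^ 2 - a\<^sub>4 E ^ 2)"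

definition division3 :: "'a::comm_ring_1 weierstrass \<Rightarrow> 'a \<Rightarrow> 'a" where
  "division3 E x = (case b_invs E of (b2, b4, b6, b8) \<Rightarrow>
     3 * x ^ 4 + b2 * x ^ 3 + 3 * b4 * x ^ 2 + 3 * b6 * x + b8)"

text \<open>The discriminant of the curve equation as a quadratic in \<open>y\<close>; on the curve
  it equals \<open>(2*y + a1*x + a3)^2\<close>.\<close>

definition division2 :: "'a::comm_ring_1 weierstrass \<Rightarrow> 'a \<Rightarrow> 'a" where
  "division2 E x = (case b_invs E of (b2, b4, b6, b8) \<Rightarrow>
     4 * x ^ 3 + b2 * x ^ 2 + 2 * b4 * x + b6)"

text \<open>Zero counts as a square, so points of order 2 are excluded.\<close>

definition nonsquare_flexes :: "'a::field weierstrass \<Rightarrow> 'a set" where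
  "nonsquare_flexes E = {x. division3 E x = 0 \<and> (\<nexists>s. division2 E x = s ^ 2)}"

lemma isomorphic_refl: "isomorphic E E"
  unfolding isomorphic_def by (rule exI[of _ 1], rule exI[of _ 0], rule exI[of _ 0], rule exI[of _ 0]) simp

lemma isomorphic_trans:
  assumes "isomorphic E E'" "isomorphic E' E''"
  shows "isomorphic E E''"
proof -
  obtain u r s w where 1: "u \<noteq> 0" "u * a\<^sub>1 E' = a\<^sub>1 E + 2 * s"
     "u ^ 2 * a\<^sub>2 E' = a\<^sub>2 E - s * a\<^sub>1 E + 3 * r - s ^ 2"
     "u ^ 3 * a\<^sub>3 E' = a\<^sub>3 E + r * a\<^sub>1 E + 2 * w"
     "u ^ 4 * a\<^sub>4 E' = a\<^sub>4 E - s * a\<^sub>3 E + 2 * r * a\<^sub>2 E - (w + r * s) * a\<^sub>1 E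
                      + 3 * r ^ 2 - 2 * s * w"
     "u ^ 6 * a\<^sub>6 E' = a\<^sub>6 E + r * a\<^sub>4 E + r ^ 2 * a\<^sub>2 E + r ^ 3 - w * a\<^sub>3 E - w ^ 2
                      - r * w * a\<^sub>1 E"
    using assms(1) unfolding isomorphic_def by auto
  obtain v r' s' w' where 2: "v \<noteq> 0" "v * a\<^sub>1 E'' = a\<^sub>1 E' + 2 * s'"
     "v ^ 2 * a\<^sub>2 E'' = a\<^sub>2 E' - s' * a\<^sub>1 E' + 3 * r' - s' ^ 2"
     "v ^ 3 * a\<^sub>3 E'' = a\<^sub>3 E' + r' * a\<^sub>1 E' + 2 * w'"
     "v ^ 4 * a\<^sub>4 E'' = a\<^sub>4 E' - s' * a\<^sub>3 E' + 2 * r' * a\<^sub>2 E' - (w' + r' * s') * a\<^sub>1 E'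
                      + 3 * r' ^ 2 - 2 * s' * w'"
     "v ^ 6 * a\<^sub>6 E'' = a\<^sub>6 E' + r' * a\<^sub>4 E' + r' ^ 2 * a\<^sub>2 E' + r' ^ 3 - w' * a\<^sub>3 E' - w' ^ 2
                      - r' * w' * a\<^sub>1 E'"
    using assms(2) unfolding isomorphic_def by auto
  \<comment> \<open>The coefficients of the composite of the two substitutions.\<close>
  let ?u = "u * v" and ?r = "u ^ 2 * r' + r" and ?s = "u * s' + s" and ?w = "u ^ 3 * w' + u ^ 2 * s * r' + w"
  have "?u * a\<^sub>1 E'' = u * (v * a\<^sub>1 E'')" by simp
  also have "\<dots> = (u * a\<^sub>1 E') + 2 * (u * s')" unfolding 2 by Groebner_Basis.algebra
  also have "\<dots> = a\<^sub>1 E + 2 * ?s" unfolding 1 by Groebner_Basis.algebra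
  finally have i1: "?u * a\<^sub>1 E'' = a\<^sub>1 E + 2 * ?s" .
  have "?u ^ 2 * a\<^sub>2 E'' = u ^ 2 * (v ^ 2 * a\<^sub>2 E'')" by Groebner_Basis.algebra
  also have "\<dots> = (u ^ 2 * a\<^sub>2 E') - (u * s') * (u * a\<^sub>1 E') + 3 * (u ^ 2 * r') - (u * s') ^ 2"
    unfolding 2 by Groebner_Basis.algebra
  also have "\<dots> = a\<^sub>2 E - ?s * a\<^sub>1 E + 3 * ?r - ?s ^ 2"
    unfolding 1 by Groebner_Basis.algebra
  finally have i2: "?u ^ 2 * a\<^sub>2 E'' = a\<^sub>2 E - ?s * a\<^sub>1 E + 3 * ?r - ?s ^ 2" .
  have "?u ^ 3 * a\<^sub>3 E'' = u ^ 3 * (v ^ 3 * a\<^sub>3 E'')" by Groebner_Basis.algebra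
  also have "\<dots> = (u ^ 3 * a\<^sub>3 E') + u ^ 2 * r' * (u * a\<^sub>1 E') + 2 * (u ^ 3 * w')"
    unfolding 2 by Groebner_Basis.algebra
  also have "\<dots> = a\<^sub>3 E + ?r * a\<^sub>1 E + 2 * ?w"
    unfolding 1 by Groebner_Basis.algebra
  finally have i3: "?u ^ 3 * a\<^sub>3 E'' = a\<^sub>3 E + ?r * a\<^sub>1 E + 2 * ?w" .
  have "?u ^ 4 * a\<^sub>4 E'' = u ^ 4 * (v ^ 4 * a\<^sub>4 E'')" by Groebner_Basis.algebra
  also have "\<dots> = (u ^ 4 * a\<^sub>4 E') - (u * s') * (u ^ 3 * a\<^sub>3 E') + 2 * (u ^ 2 * r') * (u ^ 2 * a\<^sub>2 E')
     - (u ^ 3 * w' + u ^ 3 * r' * s') * (u * a\<^sub>1 E') + 3 * (u ^ 2 * r') ^ 2 - 2 * u ^ 4 * s' * w'"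
    unfolding 2 by Groebner_Basis.algebra
  also have "\<dots> = a\<^sub>4 E - ?s * a\<^sub>3 E + 2 * ?r * a\<^sub>2 E - (?w + ?r * ?s) * a\<^sub>1 E + 3 * ?r ^ 2 - 2 * ?s * ?w"
    unfolding 1 by Groebner_Basis.algebra
  finally have i4: "?u ^ 4 * a\<^sub>4 E'' = a\<^sub>4 E - ?s * a\<^sub>3 E + 2 * ?r * a\<^sub>2 E - (?w + ?r * ?s) * a\<^sub>1 E + 3 * ?r ^ 2 - 2 * ?s * ?w" .
  have "?u ^ 6 * a\<^sub>6 E'' = u ^ 6 * (v ^ 6 * a\<^sub>6 E'')" by Groebner_Basis.algebra
  also have "\<dots> = (u ^ 6 * a\<^sub>6 E') + (u ^ 2 * r') * (u ^ 4 * a\<^sub>4 E') + (u ^ 2 * r') ^ 2 * (u ^ 2 * a\<^sub>2 E') + (u ^ 2 * r') ^ 3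
     - (u ^ 3 * w') * (u ^ 3 * a\<^sub>3 E') - (u ^ 3 * w') ^ 2 - (u ^ 2 * r') * (u ^ 3 * w') * (u * a\<^sub>1 E')"
    unfolding 2 by Groebner_Basis.algebra
  also have "\<dots> = a\<^sub>6 E + ?r * a\<^sub>4 E + ?r ^ 2 * a\<^sub>2 E + ?r ^ 3 - ?w * a\<^sub>3 E - ?w ^ 2 - ?r * ?w * a\<^sub>1 E"
    unfolding 1 by Groebner_Basis.algebra
  finally have i6: "?u ^ 6 * a\<^sub>6 E'' = a\<^sub>6 E + ?r * a\<^sub>4 E + ?r ^ 2 * a\<^sub>2 E + ?r ^ 3 - ?w * a\<^sub>3 E - ?w ^ 2 - ?r * ?w * a\<^sub>1 E" .
  have "?u \<noteq> 0"
    using 1 2 by simp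
  with i1 i2 i3 i4 i6 show ?thesis
    unfolding isomorphic_def by blast
qed

lemma isomorphic_sym:
  assumes "isomorphic E E'"
  shows "isomorphic E' E"
proof -
  obtain u r s w where 1: "u \<noteq> 0" "u * a\<^sub>1 E' = a\<^sub>1 E + 2 * s"
     "u ^ 2 * a\<^sub>2 E' = a\<^sub>2 E - s * a\<^sub>1 E + 3 * r - s ^ 2"
     "u ^ 3 * a\<^sub>3 E' = a\<^sub>3 E + r * a\<^sub>1 E + 2 * w"
     "u ^ 4 * a\<^sub>4 E' = a\<^sub>4 E - s * a\<^sub>3 E + 2 * r * a\<^sub>2 E - (w + r * s) * a\<^sub>1 E
                      + 3 * r ^ 2 - 2 * s * w"
     "u ^ 6 * a\<^sub>6 E' = a\<^sub>6 E + r * a\<^sub>4 E + r ^ 2 * a\<^sub>2 E + r ^ 3 - w * a\<^sub>3 E - w ^ 2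
                      - r * w * a\<^sub>1 E"
    using assms(1) unfolding isomorphic_def by auto
  define v where "v = 1 / u"
  have vu: "v * u = 1"
    using 1(1) by (simp add: v_def)
  have v: "v ^ n * (u ^ n * z) = z" for n z
    by (metis mult.assoc mult_1 power_mult_distrib power_one vu)
  have E': "a\<^sub>1 E' = v * (a\<^sub>1 E + 2 * s)"
     "a\<^sub>2 E' = v ^ 2 * (a\<^sub>2 E - s * a\<^sub>1 E + 3 * r - s ^ 2)"
     "a\<^sub>3 E' = v ^ 3 * (a\<^sub>3 E + r * a\<^sub>1 E + 2 * w)"
     "a\<^sub>4 E' = v ^ 4 * (a\<^sub>4 E - s * a\<^sub>3 E + 2 * r * a\<^sub>2 E - (w + r * s) * a\<^sub>1 E + 3 * r ^ 2 - 2 * s * w)"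
     "a\<^sub>6 E' = v ^ 6 * (a\<^sub>6 E + r * a\<^sub>4 E + r ^ 2 * a\<^sub>2 E + r ^ 3 - w * a\<^sub>3 E - w ^ 2 - r * w * a\<^sub>1 E)"
    unfolding 1(2-)[symmetric] v using v[of 1] by simp_all
  have "v \<noteq> 0"
    using vu by auto
  \<comment> \<open>The inverse substitution has scaling factor \<open>v = 1 / u\<close> and
    coefficients \<open>- v^2*r\<close>, \<open>- v*s\<close>, \<open>v^3*(r*s - w)\<close>.\<close>
  moreover have "v * a\<^sub>1 E = a\<^sub>1 E' + 2 * (- (v * s))"
    "v ^ 2 * a\<^sub>2 E = a\<^sub>2 E' - (- (v * s)) * a\<^sub>1 E' + 3 * (- (v ^ 2 * r)) - (- (v * s)) ^ 2"
    "v ^ 3 * a\<^sub>3 E = a\<^sub>3 E' + (- (v ^ 2 * r)) * a\<^sub>1 E' + 2 * (v ^ 3 * (r * s - w))"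
    "v ^ 4 * a\<^sub>4 E = a\<^sub>4 E' - (- (v * s)) * a\<^sub>3 E' + 2 * (- (v ^ 2 * r)) * a\<^sub>2 E' - (v ^ 3 * (r * s - w) + (- (v ^ 2 * r)) * (- (v * s))) * a\<^sub>1 E'
       + 3 * (- (v ^ 2 * r)) ^ 2 - 2 * (- (v * s)) * (v ^ 3 * (r * s - w))"
    "v ^ 6 * a\<^sub>6 E = a\<^sub>6 E' + (- (v ^ 2 * r)) * a\<^sub>4 E' + (- (v ^ 2 * r)) ^ 2 * a\<^sub>2 E' + (- (v ^ 2 * r)) ^ 3 - (v ^ 3 * (r * s - w)) * a\<^sub>3 E' - (v ^ 3 * (r * s - w)) ^ 2
       - (- (v ^ 2 * r)) * (v ^ 3 * (r * s - w)) * a\<^sub>1 E'"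
    unfolding E' by Groebner_Basis.algebra+
  ultimately show ?thesis
    unfolding isomorphic_def by blast
qed

lemma equiv_isomorphic: "equiv UNIV {(E, E'). isomorphic E E'}"
proof (rule equivI)
  show "refl {(E, E'). isomorphic E E'}"
    by (simp add: refl_on_def isomorphic_refl)
  show "sym {(E, E'). isomorphic E E'}"
    by (rule symI) (simp add: isomorphic_sym)
  show "trans {(E, E'). isomorphic E E'}"
    by (rule transI) (use isomorphic_trans in simp, blast)
qed simp_all

lemma isomorphic_invariants:
  assumes "isomorphic E E'"
  obtains u r where "u \<noteq> 0" "\<And>x. u ^ 8 * division3 E' x = division3 E (u ^ 2 * x + r)"
    "\<And>x. u ^ 6 * division2 E' x = division2 E (u ^ 2 * x + r)"
    "u ^ 12 * discriminant E' = discriminant E"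
proof -
  obtain u r s w where 1: "u \<noteq> 0" "u * a\<^sub>1 E' = a\<^sub>1 E + 2 * s"
     "u ^ 2 * a\<^sub>2 E' = a\<^sub>2 E - s * a\<^sub>1 E + 3 * r - s ^ 2"
     "u ^ 3 * a\<^sub>3 E' = a\<^sub>3 E + r * a\<^sub>1 E + 2 * w"
     "u ^ 4 * a\<^sub>4 E' = a\<^sub>4 E - s * a\<^sub>3 E + 2 * r * a\<^sub>2 E - (w + r * s) * a\<^sub>1 E
                      + 3 * r ^ 2 - 2 * s * w"
     "u ^ 6 * a\<^sub>6 E' = a\<^sub>6 E + r * a\<^sub>4 E + r ^ 2 * a\<^sub>2 E + r ^ 3 - w * a\<^sub>3 E - w ^ 2
                      - r * w * a\<^sub>1 E"
    using assms(1) unfolding isomorphic_def by auto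
  obtain b2 b4 b6 b8 where b: "b_invs E = (b2, b4, b6, b8)" by (metis prod_cases4)
  obtain c2 c4 c6 c8 where c: "b_invs E' = (c2, c4, c6, c8)" by (metis prod_cases4)
  have B: "b2 = a\<^sub>1 E ^ 2 + 4 * a\<^sub>2 E" "b4 = 2 * a\<^sub>4 E + a\<^sub>1 E * a\<^sub>3 E" "b6 = a\<^sub>3 E ^ 2 + 4 * a\<^sub>6 E"
     "b8 = a\<^sub>1 E ^ 2 * a\<^sub>6 E + 4 * a\<^sub>2 E * a\<^sub>6 E - a\<^sub>1 E * a\<^sub>3 E * a\<^sub>4 E + a\<^sub>2 E * a\<^sub>3 E ^ 2 - a\<^sub>4 E ^ 2"
    using b by (auto simp: b_invs_def)
  have C: "c2 = a\<^sub>1 E' ^ 2 + 4 * a\<^sub>2 E'" "c4 = 2 * a\<^sub>4 E' + a\<^sub>1 E' * a\<^sub>3 E'" "c6 = a\<^sub>3 E' ^ 2 + 4 * a\<^sub>6 E'"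
     "c8 = a\<^sub>1 E' ^ 2 * a\<^sub>6 E' + 4 * a\<^sub>2 E' * a\<^sub>6 E' - a\<^sub>1 E' * a\<^sub>3 E' * a\<^sub>4 E' + a\<^sub>2 E' * a\<^sub>3 E' ^ 2 - a\<^sub>4 E' ^ 2"
    using c by (auto simp: b_invs_def)
  have "u ^ 2 * c2 = (u * a\<^sub>1 E') ^ 2 + 4 * (u ^ 2 * a\<^sub>2 E')"
    unfolding C by Groebner_Basis.algebra
  also have "\<dots> = b2 + 12 * r"
    unfolding 1 B by Groebner_Basis.algebra
  finally have c2: "u ^ 2 * c2 = b2 + 12 * r" .
  have "u ^ 4 * c4 = 2 * (u ^ 4 * a\<^sub>4 E') + (u * a\<^sub>1 E') * (u ^ 3 * a\<^sub>3 E')"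
    unfolding C by Groebner_Basis.algebra
  also have "\<dots> = b4 + r * b2 + 6 * r ^ 2"
    unfolding 1 B by Groebner_Basis.algebra
  finally have c4: "u ^ 4 * c4 = b4 + r * b2 + 6 * r ^ 2" .
  have "u ^ 6 * c6 = (u ^ 3 * a\<^sub>3 E') ^ 2 + 4 * (u ^ 6 * a\<^sub>6 E')"
    unfolding C by Groebner_Basis.algebra
  also have "\<dots> = b6 + 2 * r * b4 + r ^ 2 * b2 + 4 * r ^ 3"
    unfolding 1 B by Groebner_Basis.algebra
  finally have c6: "u ^ 6 * c6 = b6 + 2 * r * b4 + r ^ 2 * b2 + 4 * r ^ 3" .
  have "u ^ 8 * c8 = (u * a\<^sub>1 E') ^ 2 * (u ^ 6 * a\<^sub>6 E') + 4 * (u ^ 2 * a\<^sub>2 E') * (u ^ 6 * a\<^sub>6 E')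
    - (u * a\<^sub>1 E') * (u ^ 3 * a\<^sub>3 E') * (u ^ 4 * a\<^sub>4 E') + (u ^ 2 * a\<^sub>2 E') * (u ^ 3 * a\<^sub>3 E') ^ 2 - (u ^ 4 * a\<^sub>4 E') ^ 2"
    unfolding C by Groebner_Basis.algebra
  also have "\<dots> = b8 + 3 * r * b6 + 3 * r ^ 2 * b4 + r ^ 3 * b2 + 3 * r ^ 4"
    unfolding 1 B by Groebner_Basis.algebra
  finally have c8: "u ^ 8 * c8 = b8 + 3 * r * b6 + 3 * r ^ 2 * b4 + r ^ 3 * b2 + 3 * r ^ 4" .
  have "u ^ 8 * division3 E' x = division3 E (u ^ 2 * x + r)" for x
  proof -
    have "u ^ 8 * division3 E' x = 3 * (u ^ 2 * x) ^ 4 + (u ^ 2 * c2) * (u ^ 2 * x) ^ 3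
      + 3 * (u ^ 4 * c4) * (u ^ 2 * x) ^ 2 + 3 * (u ^ 6 * c6) * (u ^ 2 * x) + u ^ 8 * c8"
      unfolding division3_def c prod.case by Groebner_Basis.algebra
    also have "\<dots> = division3 E (u ^ 2 * x + r)"
      unfolding c2 c4 c6 c8 division3_def b prod.case by Groebner_Basis.algebra
    finally show ?thesis .
  qed
  moreover have "u ^ 6 * division2 E' x = division2 E (u ^ 2 * x + r)" for x
  proof -
    have "u ^ 6 * division2 E' x = 4 * (u ^ 2 * x) ^ 3 + (u ^ 2 * c2) * (u ^ 2 * x) ^ 2
      + 2 * (u ^ 4 * c4) * (u ^ 2 * x) + u ^ 6 * c6"
      unfolding division2_def c prod.case by Groebner_Basis.algebra
    also have "\<dots> = division2 E (u ^ 2 * x + r)"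
      unfolding c2 c4 c6 division2_def b prod.case by Groebner_Basis.algebra
    finally show ?thesis .
  qed
  moreover have "u ^ 12 * discriminant E' = discriminant E"
  proof -
    have "u ^ 12 * discriminant E' = - ((u ^ 2 * c2) ^ 2) * (u ^ 8 * c8) - 8 * (u ^ 4 * c4) ^ 3 - 27 * (u ^ 6 * c6) ^ 2
      + 9 * (u ^ 2 * c2) * (u ^ 4 * c4) * (u ^ 6 * c6)"
      unfolding discriminant_def Let_def C[symmetric] by Groebner_Basis.algebra
    \<comment> \<open>As a polynomial in independent \<open>b2\<close>, \<open>b4\<close>,
      \<open>b6\<close>, \<open>b8\<close> the discriminant is invariant only up to a multiple of
      \<open>b2*b6 - b4^2 - 4*b8\<close>, which vanishes for the \<open>b\<close>s of a
      curve.\<close>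
    also have "\<dots> = discriminant E + (b2 * b6 - b4 ^ 2 - 4 * b8) * (36 * r ^ 2 + 6 * r * b2)"
      unfolding c2 c4 c6 c8 discriminant_def Let_def B[symmetric] 
      by Groebner_Basis.algebra
    also have "b2 * b6 - b4 ^ 2 - 4 * b8 = 0"
      unfolding B by Groebner_Basis.algebra
    finally show ?thesis by simp
  qed
  ultimately show thesis
    using that 1(1) by blast
qed

section \<open>Twists of curves in short form\<close>

lemma isomorphic_short_form:
  fixes E :: "'a::field weierstrass"
  assumes two: "(2::'a) \<noteq> 0" and three: "(3::'a) \<noteq> 0"
  obtains A B where "isomorphic E (short_weierstrass A B)"
proof -
  define s where "s = - a\<^sub>1 E / 2"
  define r where "r = (s ^ 2 + s * a\<^sub>1 E - a\<^sub>2 E) / 3"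
  define w where "w = - (a\<^sub>3 E + r * a\<^sub>1 E) / 2"
  define A where "A = a\<^sub>4 E - s * a\<^sub>3 E + 2 * r * a\<^sub>2 E - (w + r * s) * a\<^sub>1 E + 3 * r ^ 2 - 2 * s * w"
  define B where "B = a\<^sub>6 E + r * a\<^sub>4 E + r ^ 2 * a\<^sub>2 E + r ^ 3 - w * a\<^sub>3 E - w ^ 2 - r * w * a\<^sub>1 E"
  have "2 * s = - a\<^sub>1 E" "3 * r = s ^ 2 + s * a\<^sub>1 E - a\<^sub>2 E" "2 * w = - (a\<^sub>3 E + r * a\<^sub>1 E)"
    using two three by (simp_all add: s_def r_def w_def)
  then have "isomorphic E (short_weierstrass A B)"
    unfolding isomorphic_def short_weierstrass_def
    by (intro exI[of _ 1] exI[of _ r] exI[of _ s] exI[of _ w]) (simp add: A_def B_def)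
  with that show thesis .
qed

lemma isomorphic_short_iff:
  fixes A B :: "'a::field"
  assumes two: "(2::'a) \<noteq> 0" and three: "(3::'a) \<noteq> 0"
  shows "isomorphic (short_weierstrass A B) (short_weierstrass A' B') \<longleftrightarrow>
    (\<exists>u. u \<noteq> 0 \<and> u ^ 4 * A' = A \<and> u ^ 6 * B' = B)"
proof
  assume "isomorphic (short_weierstrass A B) (short_weierstrass A' B')"
  then obtain u r s w where "u \<noteq> 0" "0 = 2 * s" "3 * r - s ^ 2 = 0" "2 * w = 0"
    "u ^ 4 * A' = A + 3 * r ^ 2 - 2 * s * w" "u ^ 6 * B' = B + r * A + r ^ 3 - w ^ 2"
    unfolding isomorphic_def short_weierstrass_def by auto
  moreover from this two three have "s = 0" "w = 0" "r = 0"
    by auto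
  ultimately show "\<exists>u. u \<noteq> 0 \<and> u ^ 4 * A' = A \<and> u ^ 6 * B' = B"
    by auto
next
  assume "\<exists>u. u \<noteq> 0 \<and> u ^ 4 * A' = A \<and> u ^ 6 * B' = B"
  then obtain u where "u \<noteq> 0" "u ^ 4 * A' = A" "u ^ 6 * B' = B"
    by blast
  then show "isomorphic (short_weierstrass A B) (short_weierstrass A' B')"
    unfolding isomorphic_def short_weierstrass_def
    by (intro exI[of _ u] exI[of _ 0]) simp
qed

lemma discriminant_short: "discriminant (short_weierstrass A B) = - 16 * (4 * A ^ 3 + 27 * B ^ 2)"
  unfolding discriminant_def Let_def short_weierstrass_def weierstrass.sel
  by (simp add: algebra_simps power_mult_distrib)

lemma division_short:
  "division3 (short_weierstrass A B) x = flex_poly A B x"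
  "division2 (short_weierstrass A B) x = 4 * (x ^ 3 + A * x + B)"
  unfolding division3_def division2_def b_invs_def short_weierstrass_def weierstrass.sel prod.case flex_poly_def
  by (simp_all add: algebra_simps)

lemma isomorphic_elliptic:
  assumes "isomorphic E E'" "elliptic E"
  shows "elliptic E'"
  using isomorphic_invariants[OF assms(1)] assms(2) unfolding elliptic_def by (metis mult_zero_right)

text \<open>The substitution \<open>u^2*x + r\<close> carries one set to the other:
  \<open>division2\<close> changes by the square \<open>u ^ 6\<close>.\<close>

lemma isomorphic_card_nonsquare_flexes:
  fixes E E' :: "'a::field weierstrass"
  assumes "isomorphic E E'"
  shows "card (nonsquare_flexes E) = card (nonsquare_flexes E')"
proof -
  obtain u r where u: "u \<noteq> 0" "\<And>x. u ^ 8 * division3 E' x = division3 E (u ^ 2 * x + r)"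
    "\<And>x. u ^ 6 * division2 E' x = division2 E (u ^ 2 * x + r)"
    using isomorphic_invariants[OF assms] by metis
  have "x \<in> nonsquare_flexes E' \<longleftrightarrow> u ^ 2 * x + r \<in> nonsquare_flexes E" for x
  proof -
    have "division3 E' x = 0 \<longleftrightarrow> division3 E (u ^ 2 * x + r) = 0"
      using u(1) by (simp flip: u(2))
    moreover have "(\<exists>s. division2 E' x = s ^ 2) \<longleftrightarrow> (\<exists>s. division2 E (u ^ 2 * x + r) = s ^ 2)"
    proof safe
      fix s assume "division2 E' x = s ^ 2"
      then show "\<exists>s. division2 E (u ^ 2 * x + r) = s ^ 2"
        by (intro exI[of _ "u ^ 3 * s"]) (simp add: power_mult_distrib flip: u(3) power_mult)
    next
      fix s assume "division2 E (u ^ 2 * x + r) = s ^ 2"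
      then have "division2 E' x * u ^ 6 = s ^ 2"
        using u(3)[of x] by (simp only: mult.commute)
      then have "division2 E' x = (s / u ^ 3) ^ 2"
        using u(1) by (simp add: power_divide nonzero_eq_divide_eq flip: power_mult)
      then show "\<exists>s. division2 E' x = s ^ 2" by blast
    qed
    ultimately show ?thesis
      unfolding nonsquare_flexes_def mem_Collect_eq by blast
  qed
  then have "nonsquare_flexes E = (\<lambda>x. u ^ 2 * x + r) ` nonsquare_flexes E'"
  proof (intro equalityI subsetI)
    fix y assume *: "\<And>x. x \<in> nonsquare_flexes E' \<longleftrightarrow> u ^ 2 * x + r \<in> nonsquare_flexes E" and "y \<in> nonsquare_flexes E"
    then show "y \<in> (\<lambda>x. u ^ 2 * x + r) ` nonsquare_flexes E'"
      using u(1) by (intro image_eqI[of _ _ "(y - r) / u ^ 2"]) simp_all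
  qed auto
  moreover have "inj (\<lambda>x. u ^ 2 * x + r)"
    using u(1) by (auto simp: inj_on_def)
  ultimately show ?thesis
    by (metis card_image inj_on_subset subset_UNIV)
qed

text \<open>Half of the nonzero elements are squares. The nonzero squares and their multiples by
  \<open>t\<close> are disjoint sets of this size, hence exhaust the nonzero elements.\<close>

lemma nonsquare_mult_nonsquare:
  fixes t z :: "'a::{field,finite}"
  assumes two: "(2::'a) \<noteq> 0" and t: "\<nexists>s. t = s ^ 2" and z: "\<nexists>s. z = s ^ 2"
  shows "\<exists>s. t * z = s ^ 2"
proof -
  have t0: "t \<noteq> 0" and z0: "z \<noteq> 0"
    using t z by (metis zero_power2)+
  define Q where "Q = (\<lambda>x::'a. x ^ 2) ` (UNIV - {0})"
  have "card (UNIV - {0::'a}) = 2 * card Q"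
    unfolding Q_def
  proof (rule card_eq_mult_card_image)
    fix b :: 'a assume "b \<in> (\<lambda>x. x ^ 2) ` (UNIV - {0})"
    then obtain x where x: "x \<noteq> 0" "b = x ^ 2" by blast
    then have "{a \<in> UNIV - {0}. a ^ 2 = b} = {x, - x}"
      by (auto simp: power2_eq_iff)
    moreover have "x \<noteq> - x"
    proof
      assume "x = - x"
      then have "2 * x = 0" by (metis add.right_inverse mult_2)
      with two x show False by simp
    qed
    ultimately show "card {a \<in> UNIV - {0}. a ^ 2 = b} = 2" by simp
  qed simp
  also have "\<dots> = card Q + card ((*) t ` Q)"
    using t0 by (simp add: card_image inj_on_def)
  also have "\<dots> = card (Q \<union> (*) t ` Q)"
  proof (rule card_Un_disjoint[symmetric])
    have False if "y \<noteq> 0" "x ^ 2 = t * y ^ 2" for x y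
      using that t by (metis nonzero_eq_divide_eq power_divide power_not_zero)
    then show "Q \<inter> (*) t ` Q = {}"
      unfolding Q_def by blast
  qed (simp_all add: Q_def)
  finally have "Q \<union> (*) t ` Q = UNIV - {0}"
    using t0 by (intro card_subset_eq) (auto simp: Q_def)
  then have "z \<in> Q \<union> (*) t ` Q"
    using z0 by blast
  with z obtain y where "z = t * y ^ 2"
    unfolding Q_def by blast
  then have "t * z = (t * y) ^ 2"
    by (simp add: power2_eq_square)
  then show ?thesis by blast
qed

text \<open>Up to a square factor, the twist multiplies the value of the cubic by the non-square
  \<open>t\<close>, which exchanges nonzero squares and non-squares.\<close>

lemma nonsquare_flexes_twist:
  fixes A B t :: "'a::{field,finite}"
  assumes two: "(2::'a) \<noteq> 0" and t: "\<nexists>s. t = s ^ 2"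
  shows "nonsquare_flexes (short_weierstrass (t ^ 2 * A) (t ^ 3 * B)) = (*) t ` square_flexes A B"
proof -
  have t0: "t \<noteq> 0"
    using t by (metis zero_power2)
  have "t * x \<in> nonsquare_flexes (short_weierstrass (t ^ 2 * A) (t ^ 3 * B)) \<longleftrightarrow> x \<in> square_flexes A B" for x
  proof -
    have "flex_poly (t ^ 2 * A) (t ^ 3 * B) (t * x) = t ^ 4 * flex_poly A B x"
      unfolding flex_poly_def by Groebner_Basis.algebra
    then have "flex_poly (t ^ 2 * A) (t ^ 3 * B) (t * x) = 0 \<longleftrightarrow> flex_poly A B x = 0"
      using t0 by simp
    moreover define f where "f = x ^ 3 + A * x + B"
    have f: "4 * ((t * x) ^ 3 + t ^ 2 * A * (t * x) + t ^ 3 * B) = (2 * t) ^ 2 * (t * f)"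
      unfolding f_def by Groebner_Basis.algebra
    have "(\<nexists>s. (2 * t) ^ 2 * (t * f) = s ^ 2) \<longleftrightarrow> (\<exists>y. y \<noteq> 0 \<and> f = y ^ 2)"
    proof
      assume *: "\<nexists>s. (2 * t) ^ 2 * (t * f) = s ^ 2"
      then have "f \<noteq> 0"
        by (metis mult_zero_right zero_power2)
      have "\<nexists>s. t * f = s ^ 2"
        using * by (metis power_mult_distrib)
      then obtain s where "f = s ^ 2"
        using nonsquare_mult_nonsquare[OF two t] by blast
      with \<open>f \<noteq> 0\<close> show "\<exists>y. y \<noteq> 0 \<and> f = y ^ 2" by auto
    next
      assume "\<exists>y. y \<noteq> 0 \<and> f = y ^ 2"
      then obtain y where y: "y \<noteq> 0" "f = y ^ 2" by blast
      have False if "(2 * t) ^ 2 * (t * f) = s ^ 2" for s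
      proof -
        have "(4::'a) \<noteq> 0"
          using power_not_zero[OF two, of 2] by simp
        then have "t = (s / (2 * t * y)) ^ 2"
          using that y two t0 unfolding power_divide that[symmetric] by (simp add: power_mult_distrib)
        with t show False by blast
      qed
      then show "\<nexists>s. (2 * t) ^ 2 * (t * f) = s ^ 2" by blast
    qed
    ultimately show ?thesis
      unfolding nonsquare_flexes_def square_flexes_def mem_Collect_eq division_short f f_def by blast
  qed
  note * = this
  show ?thesis
  proof (intro equalityI subsetI)
    fix y assume "y \<in> nonsquare_flexes (short_weierstrass (t ^ 2 * A) (t ^ 3 * B))"
    with *[of "y / t"] t0 show "y \<in> (*) t ` square_flexes A B"
      by (intro image_eqI[of _ _ "y / t"]) simp_all
  qed (use * in auto)
qed

fun neg_point :: "'a::field weierstrass \<Rightarrow> 'a point \<Rightarrow> 'a point" where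
  "neg_point E Infinity = Infinity"
| "neg_point E (Affine x y) = Affine x (- y - a\<^sub>1 E * x - a\<^sub>3 E)"

section \<open>Subgroups of order 3\<close>

lemma eq_neg_diff_iff: "z = - y - b - c \<longleftrightarrow> y + z + b + c = (0::'a::ab_group_add)"
proof -
  have "z - (- y - b - c) = y + z + b + c"
    by (simp add: algebra_simps)
  then show ?thesis
    by (metis right_minus_eq)
qed

lemma eq_self_neg_diff_iff: "y = - y - b - c \<longleftrightarrow> 2 * y + b + c = (0::'a::comm_ring_1)"
  unfolding eq_neg_diff_iff mult_2 ..

lemma neg_neg_point [simp]: "neg_point E (neg_point E P) = P"
  by (cases P) simp_all

lemma on_curve_neg_point: "on_curve E (neg_point E P) \<longleftrightarrow> on_curve E P"
proof (cases P)
  case (Affine x y)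
  have "(- y - a\<^sub>1 E * x - a\<^sub>3 E) ^ 2 + a\<^sub>1 E * x * (- y - a\<^sub>1 E * x - a\<^sub>3 E) + a\<^sub>3 E * (- y - a\<^sub>1 E * x - a\<^sub>3 E)
    = y ^ 2 + a\<^sub>1 E * x * y + a\<^sub>3 E * y"
    by Groebner_Basis.algebra
  with Affine show ?thesis by simp
qed simp

lemma on_curve_same_x:
  assumes "on_curve E (Affine x y)" "on_curve E (Affine x y')"
  shows "y' = y \<or> y' = - y - a\<^sub>1 E * x - a\<^sub>3 E"
proof -
  have "(y' - y) * (y' + y + a\<^sub>1 E * x + a\<^sub>3 E) =
    (y' ^ 2 + a\<^sub>1 E * x * y' + a\<^sub>3 E * y') - (y ^ 2 + a\<^sub>1 E * x * y + a\<^sub>3 E * y)"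
    by Groebner_Basis.algebra
  also have "\<dots> = 0"
    using assms by simp
  finally have "y' - y = 0 \<or> y' + y + a\<^sub>1 E * x + a\<^sub>3 E = 0"
    by simp
  then show ?thesis
    unfolding eq_neg_diff_iff add.commute[of y y'] by simp
qed

lemma add_point_eq_Infinity_iff: "add_point E P Q = Infinity \<longleftrightarrow> Q = neg_point E P"
  by (cases P; cases Q) (auto simp: Let_def eq_neg_diff_iff)

lemma point_group_simps [simp]:
  "carrier (point_group E) = {P. on_curve E P}"
  "P \<otimes>\<^bsub>point_group E\<^esub> Q = add_point E P Q"
  "\<one>\<^bsub>point_group E\<^esub> = Infinity"
  by (simp_all add: point_group_def)

text \<open>The inverse is a definite description; \<open>add_point_eq_Infinity_iff\<close> turns
  its condition into equations solved by \<open>neg_point\<close> alone.\<close>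

lemma inv_point_group:
  assumes "on_curve E P"
  shows "inv\<^bsub>point_group E\<^esub> P = neg_point E P"
  unfolding m_inv_def point_group_simps mem_Collect_eq add_point_eq_Infinity_iff
proof (rule the_equality)
  show "on_curve E (neg_point E P) \<and> neg_point E P = neg_point E P \<and> P = neg_point E (neg_point E P)"
    using assms by (simp add: on_curve_neg_point)
qed blast

text \<open>Divided by the square of \<open>2*y + a1*x + a3\<close>, the left-hand side is the first
  coordinate of \<open>2P\<close> minus that of \<open>P\<close>. On the curve only
  \<open>division3\<close> remains on the right.\<close>

lemma tangent_at_flex:
  fixes E :: "'a::field weierstrass"
  shows "(3 * x ^ 2 + 2 * a\<^sub>2 E * x + a\<^sub>4 E - a\<^sub>1 E * y) ^ 2
     + a\<^sub>1 E * (3 * x ^ 2 + 2 * a\<^sub>2 E * x + a\<^sub>4 E - a\<^sub>1 E * y) * (2 * y + a\<^sub>1 E * x + a\<^sub>3 E)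
     - (a\<^sub>2 E + 3 * x) * (2 * y + a\<^sub>1 E * x + a\<^sub>3 E) ^ 2
   = - division3 E x - (a\<^sub>1 E ^ 2 + 4 * a\<^sub>2 E + 12 * x) *
       (y ^ 2 + a\<^sub>1 E * x * y + a\<^sub>3 E * y - (x ^ 3 + a\<^sub>2 E * x ^ 2 + a\<^sub>4 E * x + a\<^sub>6 E))"
  unfolding division3_def b_invs_def prod.case by Groebner_Basis.algebra

lemma division2_on_curve:
  assumes "on_curve E (Affine x y)"
  shows "division2 E x = (2 * y + a\<^sub>1 E * x + a\<^sub>3 E) ^ 2"
proof -
  have "division2 E x = (2 * y + a\<^sub>1 E * x + a\<^sub>3 E) ^ 2 - 4 *
       (y ^ 2 + a\<^sub>1 E * x * y + a\<^sub>3 E * y - (x ^ 3 + a\<^sub>2 E * x ^ 2 + a\<^sub>4 E * x + a\<^sub>6 E))"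
    unfolding division2_def b_invs_def prod.case by Groebner_Basis.algebra
  with assms show ?thesis by simp
qed

text \<open>If \<open>2P\<close> has the first coordinate of \<open>P\<close>, the addition formula
  returns the second coordinate of \<open>-P\<close>. So \<open>2P = -P\<close> is the condition of
  \<open>tangent_at_flex\<close>, and \<open>2P = P\<close> would make \<open>P\<close> its own
  negative.\<close>

lemma double_eq_neg_iff:
  assumes "on_curve E (Affine x y)" and t: "2 * y + a\<^sub>1 E * x + a\<^sub>3 E \<noteq> 0"
  shows "add_point E (Affine x y) (Affine x y) = neg_point E (Affine x y) \<longleftrightarrow> division3 E x = 0"
    and "add_point E (Affine x y) (Affine x y) \<noteq> Affine x y"
proof -
  define n t where "n = 3 * x ^ 2 + 2 * a\<^sub>2 E * x + a\<^sub>4 E - a\<^sub>1 E * y" and "t = 2 * y + a\<^sub>1 E * x + a\<^sub>3 E"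
  define x3 where "x3 = (n / t) ^ 2 + a\<^sub>1 E * (n / t) - a\<^sub>2 E - x - x"
  have t0: "t \<noteq> 0" using t by (simp add: t_def)
  have sum: "add_point E (Affine x y) (Affine x y) = Affine x3 (- (n / t * (x3 - x) + y) - a\<^sub>1 E * x3 - a\<^sub>3 E)"
  proof -
    have "(x = x \<and> y + y + a\<^sub>1 E * x + a\<^sub>3 E = 0) = False"
      using t unfolding mult_2 by (simp only: simp_thms)
    then show ?thesis
      by (simp only: add_point.simps if_False Let_def simp_thms if_True x3_def n_def t_def)
  qed
  have "x3 = x \<longleftrightarrow> t ^ 2 * (x3 - x) = 0"
    using t0 by simp
  also have "t ^ 2 * (x3 - x) = n ^ 2 + a\<^sub>1 E * n * t - (a\<^sub>2 E + 3 * x) * t ^ 2"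
    using t0 unfolding x3_def by (simp add: field_simps power2_eq_square)
  also have "\<dots> = - division3 E x"
    unfolding n_def t_def tangent_at_flex using assms(1) by simp
  finally show "add_point E (Affine x y) (Affine x y) = neg_point E (Affine x y) \<longleftrightarrow> division3 E x = 0"
    unfolding sum by auto
  show "add_point E (Affine x y) (Affine x y) \<noteq> Affine x y"
  proof
    assume "add_point E (Affine x y) (Affine x y) = Affine x y"
    then have "x3 = x" "- (n / t * (x3 - x) + y) - a\<^sub>1 E * x3 - a\<^sub>3 E = y"
      unfolding sum by auto
    then have "y = - y - a\<^sub>1 E * x - a\<^sub>3 E"
      by simp
    then have "t = 0"
      unfolding eq_self_neg_diff_iff t_def .
    with t0 show False ..
  qed
qed

text \<open>Both partial derivatives vanish at the point. Solving for \<open>a3\<close>,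
  \<open>a4\<close>, \<open>a6\<close> turns the discriminant into the zero polynomial.\<close>

lemma singular_point:
  assumes "on_curve E (Affine x y)" and "2 * y + a\<^sub>1 E * x + a\<^sub>3 E = 0"
    and "a\<^sub>1 E * y = 3 * x ^ 2 + 2 * a\<^sub>2 E * x + a\<^sub>4 E"
  shows "discriminant E = 0"
proof -
  have a3: "a\<^sub>3 E = - 2 * y - a\<^sub>1 E * x" and a4: "a\<^sub>4 E = a\<^sub>1 E * y - 3 * x ^ 2 - 2 * a\<^sub>2 E * x"
  proof -
    have "2 * y + a\<^sub>1 E * x + a\<^sub>3 E - 2 * y - a\<^sub>1 E * x = a\<^sub>3 E"
      "3 * x ^ 2 + 2 * a\<^sub>2 E * x + a\<^sub>4 E - 3 * x ^ 2 - 2 * a\<^sub>2 E * x = a\<^sub>4 E"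
      by simp_all
    then show "a\<^sub>3 E = - 2 * y - a\<^sub>1 E * x" "a\<^sub>4 E = a\<^sub>1 E * y - 3 * x ^ 2 - 2 * a\<^sub>2 E * x"
      unfolding assms(2) assms(3)[symmetric] by simp_all
  qed
  have "a\<^sub>6 E = y ^ 2 + a\<^sub>1 E * x * y + a\<^sub>3 E * y - (x ^ 3 + a\<^sub>2 E * x ^ 2 + a\<^sub>4 E * x)"
    using assms(1) by (simp add: algebra_simps)
  then have a6: "a\<^sub>6 E = - (y ^ 2) - a\<^sub>1 E * x * y + 2 * x ^ 3 + a\<^sub>2 E * x ^ 2"
    unfolding a3 a4 by (simp add: algebra_simps power2_eq_square power3_eq_cube)
  show ?thesis
    unfolding discriminant_def Let_def a6 a3 a4 by Groebner_Basis.algebra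
qed

text \<open>Otherwise the chord meets the curve doubly at the 2-torsion point, whose only tangent is vertical.\<close>

lemma chord_at_2_torsion:
  assumes ell: "elliptic E" and P: "on_curve E (Affine x1 y1)" "on_curve E (Affine x2 y2)"
    and t: "2 * y1 + a\<^sub>1 E * x1 + a\<^sub>3 E = 0" and neq: "x1 \<noteq> x2"
    and l: "l * (x2 - x1) = y2 - y1"
  shows "l ^ 2 + a\<^sub>1 E * l - a\<^sub>2 E - x1 - x2 \<noteq> x1"
proof
  assume x3: "l ^ 2 + a\<^sub>1 E * l - a\<^sub>2 E - x1 - x2 = x1"
  define F where "F x y = y ^ 2 + a\<^sub>1 E * x * y + a\<^sub>3 E * y - (x ^ 3 + a\<^sub>2 E * x ^ 2 + a\<^sub>4 E * x + a\<^sub>6 E)" for x y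
  define d where "d = x2 - x1"
  have 2: "x2 = x1 + d" "y2 = y1 + l * d"
    using l by (simp_all add: d_def)
  \<comment> \<open>Taylor expansion of \<open>F\<close> along the chord. The coefficient of
    \<open>d\<close> is the partial derivative in \<open>x\<close> plus \<open>l\<close> times that
    in \<open>y\<close>; the higher terms contain the distance from \<open>x1\<close> to the third
    intersection.\<close>
  have "d * (a\<^sub>1 E * y1 - (3 * x1 ^ 2 + 2 * a\<^sub>2 E * x1 + a\<^sub>4 E)) =
    F x2 y2 - F x1 y1 - d * l * (2 * y1 + a\<^sub>1 E * x1 + a\<^sub>3 E) - d ^ 2 * ((l ^ 2 + a\<^sub>1 E * l - a\<^sub>2 E - x1 - x2) - x1)"
    unfolding F_def 2 by Groebner_Basis.algebra
  also have "\<dots> = 0"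
    using P unfolding x3 t by (simp add: F_def)
  finally have "a\<^sub>1 E * y1 = 3 * x1 ^ 2 + 2 * a\<^sub>2 E * x1 + a\<^sub>4 E"
    using neq by (simp add: d_def)
  with singular_point[OF P(1) t] ell show False
    by (simp add: elliptic_def)
qed

text \<open>Let \<open>G\<close> consist of \<open>O\<close>, \<open>P\<close>, \<open>Q\<close>. If
  \<open>P\<close> had order 2, then \<open>P + Q\<close> would have to be \<open>P\<close> or
  \<open>Q\<close>, and \<open>chord_at_2_torsion\<close> excludes both. So \<open>Q = -P\<close>,
  and \<open>2P\<close>, being neither \<open>O\<close> nor \<open>P\<close>, is
  \<open>-P\<close>.\<close>

lemma order3_subgroup_iff:
  assumes ell: "elliptic E"
  shows "subgroup G (point_group E) \<and> card G = 3 \<longleftrightarrow>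
    (\<exists>x y. on_curve E (Affine x y) \<and> 2 * y + a\<^sub>1 E * x + a\<^sub>3 E \<noteq> 0 \<and> division3 E x = 0 \<and>
      G = {Infinity, Affine x y, neg_point E (Affine x y)})"
proof
  assume G: "subgroup G (point_group E) \<and> card G = 3"
  then interpret subgroup G "point_group E" by simp
  have O: "Infinity \<in> G"
    using one_closed by simp
  have on: "on_curve E P" if "P \<in> G" for P
    using subset that by auto
  have plus: "add_point E P Q \<in> G" if "P \<in> G" "Q \<in> G" for P Q
    using m_closed[OF that] by simp
  have neg: "neg_point E P \<in> G" if "P \<in> G" for P
    using m_inv_closed[OF that] inv_point_group[OF on[OF that]] by simp
  have "card (G - {Infinity}) = 2"
    using G O by simp
  then obtain P Q where "G - {Infinity} = {P, Q}" "P \<noteq> Q"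
    by (auto simp: card_2_iff)
  moreover from this have "P \<noteq> Infinity" "Q \<noteq> Infinity"
    by auto
  ultimately obtain x1 y1 x2 y2 where PQ: "P = Affine x1 y1" "Q = Affine x2 y2" "P \<noteq> Q" "G = {Infinity, P, Q}"
    using O by (metis insert_Diff point.exhaust)
  then have onP: "on_curve E (Affine x1 y1)" and onQ: "on_curve E (Affine x2 y2)"
    using on by blast+
  have t: "2 * y1 + a\<^sub>1 E * x1 + a\<^sub>3 E \<noteq> 0"
  proof
    assume t: "2 * y1 + a\<^sub>1 E * x1 + a\<^sub>3 E = 0"
    then have self: "- y1 - a\<^sub>1 E * x1 - a\<^sub>3 E = y1"
      using eq_self_neg_diff_iff by metis
    have neq: "x1 \<noteq> x2"
      using on_curve_same_x[OF onP, of y2] onQ self PQ by auto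
    define l where "l = (y2 - y1) / (x2 - x1)"
    define x3 where "x3 = l ^ 2 + a\<^sub>1 E * l - a\<^sub>2 E - x1 - x2"
    have l: "l * (x2 - x1) = y2 - y1"
      using neq by (simp add: l_def)
    have sum: "add_point E P Q = Affine x3 (- (l * (x3 - x1) + y1) - a\<^sub>1 E * x3 - a\<^sub>3 E)"
      by (simp only: PQ add_point.simps neq simp_thms if_False Let_def x3_def l_def)
    have "add_point E P Q \<in> {P, Q}"
      using plus[of P Q] PQ(4) sum by auto
    moreover have "add_point E P Q \<noteq> P"
      using chord_at_2_torsion[OF ell onP onQ t neq l] unfolding sum by (simp add: PQ x3_def)
    \<comment> \<open>In this case \<open>Q\<close> is its own negative, and the chord argument
      applies with \<open>P\<close> and \<open>Q\<close> exchanged.\<close>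
    moreover have "add_point E P Q \<noteq> Q"
    proof
      assume "add_point E P Q = Q"
      then have x3: "x3 = x2" and "- (l * (x3 - x1) + y1) - a\<^sub>1 E * x3 - a\<^sub>3 E = y2"
        unfolding sum unfolding PQ(2) point.inject by blast+
      then have "y2 = - y2 - a\<^sub>1 E * x2 - a\<^sub>3 E"
        using l by simp
      then have "2 * y2 + a\<^sub>1 E * x2 + a\<^sub>3 E = 0"
        unfolding eq_self_neg_diff_iff .
      moreover have "l * (x1 - x2) = y1 - y2"
        using l by (metis minus_diff_eq mult_minus_right)
      ultimately have "l ^ 2 + a\<^sub>1 E * l - a\<^sub>2 E - x2 - x1 \<noteq> x2"
        using chord_at_2_torsion[OF ell onQ onP _ neq[symmetric]] by blast
      with x3 show False
        by (simp add: x3_def algebra_simps)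
    qed
    ultimately show False by blast
  qed
  have nP: "neg_point E P \<noteq> P"
  proof
    assume "neg_point E P = P"
    then have "y1 = - y1 - a\<^sub>1 E * x1 - a\<^sub>3 E"
      by (simp add: PQ)
    with t show False
      unfolding eq_self_neg_diff_iff by simp
  qed
  then have Q: "Q = neg_point E P"
    using neg[of P] PQ by auto
  have "add_point E P P \<noteq> Infinity"
    using nP by (metis add_point_eq_Infinity_iff)
  moreover have "add_point E P P \<noteq> P"
    unfolding PQ by (rule double_eq_neg_iff(2)[OF onP t])
  ultimately have "add_point E P P = neg_point E P"
    using plus[of P P] PQ(4) Q by auto
  then have "division3 E x1 = 0"
    unfolding PQ using double_eq_neg_iff(1)[OF onP t] by simp
  with onP t PQ(4) show "\<exists>x y. on_curve E (Affine x y) \<and> 2 * y + a\<^sub>1 E * x + a\<^sub>3 E \<noteq> 0 \<and> division3 E x = 0 \<and>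
      G = {Infinity, Affine x y, neg_point E (Affine x y)}"
    unfolding Q PQ(1) by blast
next
  assume "\<exists>x y. on_curve E (Affine x y) \<and> 2 * y + a\<^sub>1 E * x + a\<^sub>3 E \<noteq> 0 \<and> division3 E x = 0 \<and>
      G = {Infinity, Affine x y, neg_point E (Affine x y)}"
  then obtain x y where xy: "on_curve E (Affine x y)" "2 * y + a\<^sub>1 E * x + a\<^sub>3 E \<noteq> 0" "division3 E x = 0"
    and G: "G = {Infinity, Affine x y, neg_point E (Affine x y)}"
    by blast
  define P where "P = Affine x y"
  define N where "N = neg_point E P"
  have N: "N = Affine x (- y - a\<^sub>1 E * x - a\<^sub>3 E)"
    by (simp add: N_def P_def)
  have onP: "on_curve E P" and onN: "on_curve E N"
    using xy(1) unfolding N_def P_def on_curve_neg_point by simp_all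
  have t': "2 * (- y - a\<^sub>1 E * x - a\<^sub>3 E) + a\<^sub>1 E * x + a\<^sub>3 E = - (2 * y + a\<^sub>1 E * x + a\<^sub>3 E)"
    by Groebner_Basis.algebra
  have nN: "neg_point E N = P"
    by (simp add: N_def)
  have tN: "2 * (- y - a\<^sub>1 E * x - a\<^sub>3 E) + a\<^sub>1 E * x + a\<^sub>3 E \<noteq> 0"
    using xy(2) unfolding t' by (simp only: neg_equal_0_iff_equal not_False_eq_True)
  have "add_point E P P = N"
    using double_eq_neg_iff(1)[OF xy(1,2)] xy(3) unfolding P_def N_def by blast
  moreover have "add_point E N N = neg_point E N"
    using double_eq_neg_iff(1)[OF onN[unfolded N] tN] xy(3) unfolding N by blast
  then have "add_point E N N = P"
    unfolding nN .
  moreover have "add_point E P N = Infinity" "add_point E N P = Infinity"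
    by (simp_all add: add_point_eq_Infinity_iff N_def)
  moreover have "add_point E P Infinity = P" "add_point E N Infinity = N"
    by (simp_all add: P_def N)
  moreover have G': "G = {Infinity, P, N}"
    by (simp add: G P_def N_def)
  ultimately have plus: "add_point E R S \<in> G" if "R \<in> G" "S \<in> G" for R S
    using that by auto
  have "subgroup G (point_group E)"
  proof (rule subgroup.intro)
    show "G \<subseteq> carrier (point_group E)"
      using onP onN by (simp add: G')
    show "R \<otimes>\<^bsub>point_group E\<^esub> S \<in> G" if "R \<in> G" "S \<in> G" for R S
      using plus[OF that] by simp
    show "\<one>\<^bsub>point_group E\<^esub> \<in> G"
      by (simp add: G')
    show "inv\<^bsub>point_group E\<^esub> R \<in> G" if "R \<in> G" for R
      using that onP onN nN by (auto simp: G' inv_point_group N_def)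
  qed
  moreover have "P \<noteq> N"
  proof
    assume "P = N"
    then have "y = - y - a\<^sub>1 E * x - a\<^sub>3 E"
      by (simp add: N P_def)
    with xy(2) show False
      unfolding eq_self_neg_diff_iff by simp
  qed
  then have "card G = 3"
    unfolding G' by (simp add: P_def N)
  ultimately show "subgroup G (point_group E) \<and> card G = 3" ..
qed

section \<open>Rationality\<close>

lemma power_CARD_eq: "x ^ CARD('a) = (x :: 'a::{field,finite})"
proof (cases "x = 0")
  case False
  have "x ^ card (UNIV - {0::'a}) * \<Prod>(UNIV - {0}) = (\<Prod>y\<in>UNIV - {0}. x * y)"
    by (simp add: prod.distrib)
  also have "\<dots> = \<Prod>(UNIV - {0})"
    by (rule prod.reindex_bij_witness[of _ "\<lambda>y. y / x" "\<lambda>y. x * y"]) (use False in auto)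
  finally have "x ^ card (UNIV - {0::'a}) = 1"
    by simp
  moreover have "CARD('a) = Suc (card (UNIV - {0::'a}))"
    by (rule card.remove) auto
  ultimately show ?thesis
    by (simp only: power_Suc mult_1_right)
qed (simp add: finite_UNIV_card_ge_0)

lemma CARD_gt_1: "CARD('a::{field,finite}) > 1"
proof -
  have "card {0, 1 :: 'a} \<le> CARD('a)"
    by (rule card_mono) auto
  then show ?thesis by simp
qed

text \<open>All \<open>q\<close> elements of the base field are roots of \<open>X^q - X\<close>,
  which has no more than \<open>q\<close> roots.\<close>

lemma range_to_ac_iff:
  fixes x :: "'a::{field,finite} alg_closure"
  shows "x \<in> range to_ac \<longleftrightarrow> x ^ CARD('a) = x"
proof -
  let ?p = "monom 1 CARD('a) + [:0, - 1 :: 'a alg_closure:]"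
  have deg: "Polynomial.degree ?p = CARD('a)"
    using CARD_gt_1[where 'a = 'a] by (subst degree_add_eq_left) (simp_all add: degree_monom_eq)
  then have p0: "?p \<noteq> 0"
    using CARD_gt_1[where 'a = 'a] by (metis degree_0 not_less_zero)
  have roots: "{x. poly ?p x = 0} = {x. x ^ CARD('a) = x}"
    by (simp add: poly_monom)
  have "range to_ac \<subseteq> {x. poly ?p x = 0}"
    unfolding roots by (auto simp: power_CARD_eq simp flip: to_ac_power)
  moreover have "card {x. poly ?p x = 0} \<le> card (range (to_ac :: 'a \<Rightarrow> _))"
    using card_poly_roots_bound[OF p0] deg by (simp add: card_image inj_to_ac)
  ultimately have "range to_ac = {x. poly ?p x = 0}"
    using poly_roots_finite[OF p0] by (metis card_seteq)
  then show ?thesis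
    unfolding roots by blast
qed

text \<open>The two sides differ by a polynomial in \<open>x\<close> of degree below \<open>q\<close>
  that vanishes at all \<open>q\<close> elements of the base field.\<close>

lemma power_CARD_add_to_ac:
  fixes x :: "'a::{field,finite} alg_closure"
  shows "(x + to_ac b) ^ CARD('a) = x ^ CARD('a) + to_ac b"
proof -
  let ?q = "CARD('a)"
  let ?r = "[:to_ac b, 1:] ^ ?q"
  let ?p = "?r - monom 1 ?q - [:to_ac b:]"
  have q: "?q > 0"
    using CARD_gt_1[where 'a = 'a] by simp
  have dr: "Polynomial.degree ?r = ?q" "poly.coeff ?r ?q = 1"
    using lead_coeff_power[of "[:to_ac b, 1:]" ?q] by (simp_all add: degree_linear_power)
  have poly_p: "poly ?p y = (y + to_ac b) ^ ?q - y ^ ?q - to_ac b" for y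
    by (simp add: poly_monom add.commute)
  have "?p = 0"
  proof (rule ccontr)
    assume p0: "?p \<noteq> 0"
    have "Polynomial.degree ?p \<le> ?q"
      using dr by (intro degree_diff_le) (simp_all add: degree_monom_eq)
    moreover have "poly.coeff ?p ?q = 0"
      using dr q by (simp add: coeff_pCons split: nat.splits)
    ultimately have "Polynomial.degree ?p < ?q"
      using p0 by (metis leading_coeff_0_iff nat_less_le)
    moreover have "range to_ac \<subseteq> {y. poly ?p y = 0}"
    proof (rule image_subsetI)
      fix z :: 'a
      have "(to_ac z + to_ac b) ^ ?q = to_ac z + to_ac b" "to_ac z ^ ?q = to_ac z"
        by (metis power_CARD_eq to_ac_add to_ac_power)+
      then show "to_ac z \<in> {y. poly ?p y = 0}"
        unfolding mem_Collect_eq poly_p by simp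
    qed
    then have "card (range (to_ac :: 'a \<Rightarrow> _)) \<le> card {y. poly ?p y = 0}"
      by (intro card_mono poly_roots_finite p0)
    ultimately show False
      using card_poly_roots_bound[OF p0] by (simp add: card_image inj_to_ac)
  qed
  then have "(x + to_ac b) ^ ?q - x ^ ?q - to_ac b = 0"
    using poly_p[of x] by (metis poly_0)
  then show ?thesis
    by (metis add.commute diff_diff_eq right_minus_eq)
qed

lemma to_ac_division:
  "division2 (map_weierstrass to_ac E) (to_ac x) = to_ac (division2 E x)"
  "division3 (map_weierstrass to_ac E) (to_ac x) = to_ac (division3 E x)"
  unfolding division2_def division3_def b_invs_def prod.case by (simp_all add: weierstrass.map_sel)

lemma to_ac_discriminant: "discriminant (map_weierstrass to_ac E) = to_ac (discriminant E)"
  unfolding discriminant_def Let_def by (simp add: weierstrass.map_sel)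

text \<open>The square of \<open>z = 2 * y + to_ac c\<close> lies in the base field, so Frobenius
  maps \<open>z\<close> to \<open>z\<close> or \<open>- z\<close>; that is, it fixes the point or
  negates it.\<close>

lemma power_CARD_on_curve:
  fixes E :: "'a::{field,finite} weierstrass"
  assumes two: "(2::'a) \<noteq> 0"
    and on: "on_curve (map_weierstrass to_ac E) (Affine (to_ac x) y)"
  defines "c \<equiv> a\<^sub>1 E * x + a\<^sub>3 E"
  shows "y ^ CARD('a) = y \<or> y ^ CARD('a) = - y - to_ac c" and "(y ^ CARD('a)) ^ CARD('a) = y"
proof -
  let ?q = "CARD('a)"
  have two': "(2 :: 'a alg_closure) \<noteq> 0"
    using two by (metis to_ac_eq_0_iff to_ac_numeral)
  have num: "(2 :: 'a alg_closure) ^ ?q = 2" "(- 1 :: 'a alg_closure) ^ ?q = - 1"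
    using power_CARD_eq[of "2::'a"] power_CARD_eq[of "-1::'a"]
    by (metis to_ac_numeral to_ac_power, metis to_ac_1 to_ac_minus to_ac_power)
  define z where "z = 2 * y + to_ac c"
  have z: "z ^ 2 = to_ac (division2 E x)"
    using division2_on_curve[OF on] by (simp add: to_ac_division z_def c_def weierstrass.map_sel add.assoc)
  have "(z ^ ?q) ^ 2 = (z ^ 2) ^ ?q"
    by (simp add: mult.commute flip: power_mult)
  also have "\<dots> = z ^ 2"
    unfolding z by (simp add: power_CARD_eq flip: to_ac_power)
  finally have "z ^ ?q = z \<or> z ^ ?q = - z"
    by (simp add: power2_eq_iff)
  moreover have "z ^ ?q = 2 * y ^ ?q + to_ac c"
    unfolding z_def power_CARD_add_to_ac power_mult_distrib num ..
  ultimately have "2 * y ^ ?q = 2 * y \<or> 2 * y ^ ?q = 2 * (- y - to_ac c)"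
    unfolding z_def by (auto simp: algebra_simps eq_neg_iff_add_eq_0)
  then show *: "y ^ ?q = y \<or> y ^ ?q = - y - to_ac c"
    unfolding mult_cancel_left using two' by blast
  have "(- y - to_ac c) ^ ?q = - (y ^ ?q) - to_ac c"
  proof -
    have "- y - to_ac c = (- 1) * (y + to_ac c)" by simp
    then show ?thesis
      by (simp only: power_mult_distrib num power_CARD_add_to_ac) simp
  qed
  with * show "(y ^ ?q) ^ ?q = y" by auto
qed

text \<open>Given as a fibre of the first coordinate, so that no choice of \<open>y\<close>
  enters.\<close>

definition flex_subgroup :: "'a::{field,finite} weierstrass \<Rightarrow> 'a \<Rightarrow> 'a alg_closure point set" where
  "flex_subgroup E x = insert Infinity {P. on_curve (map_weierstrass to_ac E) P \<and> (\<exists>y. P = Affine (to_ac x) y)}"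

lemma flex_subgroup_eq:
  assumes "on_curve (map_weierstrass to_ac E) (Affine (to_ac x) y)"
  shows "flex_subgroup E x = {Infinity, Affine (to_ac x) y, neg_point (map_weierstrass to_ac E) (Affine (to_ac x) y)}"
proof (intro equalityI subsetI)
  let ?E = "map_weierstrass to_ac E"
  fix P assume "P \<in> flex_subgroup E x"
  then consider "P = Infinity" | y' where "P = Affine (to_ac x) y'" "on_curve ?E (Affine (to_ac x) y')"
    unfolding flex_subgroup_def by blast
  then show "P \<in> {Infinity, Affine (to_ac x) y, neg_point ?E (Affine (to_ac x) y)}"
    using on_curve_same_x[OF assms] by cases auto
next
  let ?E = "map_weierstrass to_ac E"
  fix P assume "P \<in> {Infinity, Affine (to_ac x) y, neg_point ?E (Affine (to_ac x) y)}"
  moreover have "on_curve ?E (neg_point ?E (Affine (to_ac x) y))"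
    using assms by (simp only: on_curve_neg_point)
  ultimately show "P \<in> flex_subgroup E x"
    using assms unfolding flex_subgroup_def by auto
qed

lemma ex_point_above:
  fixes E :: "'a::alg_closed_field weierstrass"
  obtains y where "on_curve E (Affine x y)"
proof -
  let ?p = "[:- (x ^ 3 + a\<^sub>2 E * x ^ 2 + a\<^sub>4 E * x + a\<^sub>6 E), a\<^sub>1 E * x + a\<^sub>3 E, 1:]"
  obtain y where "poly ?p y = 0"
    using alg_closed_imp_poly_has_root[of ?p] by auto
  then have "on_curve E (Affine x y)"
    by (simp add: algebra_simps power2_eq_square)
  with that show thesis .
qed

lemma quadratic_order3_subgroups_eq:
  fixes E :: "'a::{field,finite} weierstrass"
  assumes ell: "elliptic E" and two: "(2::'a) \<noteq> 0"
  shows "quadratic_order3_subgroups E = flex_subgroup E ` nonsquare_flexes E"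
proof (intro equalityI subsetI)
  let ?E = "map_weierstrass to_ac E" and ?q = "CARD('a)"
  have ell': "elliptic ?E"
    using ell by (simp add: elliptic_def to_ac_discriminant)
  have two': "(2 :: 'a alg_closure) \<noteq> 0"
    using two by (metis to_ac_eq_0_iff to_ac_numeral)
  have sel: "a\<^sub>1 ?E = to_ac (a\<^sub>1 E)" "a\<^sub>3 ?E = to_ac (a\<^sub>3 E)"
    by (simp_all add: weierstrass.map_sel)
  {
    fix G assume "G \<in> quadratic_order3_subgroups E"
    then have "subgroup G (point_group ?E) \<and> card G = 3" and rat: "rational_set G"
      and nb: "\<And>P. P \<in> G - {Infinity} \<Longrightarrow> \<not> defined_over_base P"
      unfolding quadratic_order3_subgroups_def geometric_group_def by auto
    then obtain x y where xy: "on_curve ?E (Affine x y)" "division3 ?E x = 0"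
      and G: "G = {Infinity, Affine x y, neg_point ?E (Affine x y)}"
      unfolding order3_subgroup_iff[OF ell'] by blast
    \<comment> \<open>Both affine points of \<open>G\<close> have first coordinate \<open>x\<close>,
      so stability under Frobenius forces \<open>x ^ q = x\<close>.\<close>
    have "frobenius_point (Affine x y) \<in> G"
      using rat G unfolding rational_set_def by blast
    then have "x ^ ?q = x"
      unfolding G by (auto simp: frobenius_point_def)
    then obtain x0 where x0: "x = to_ac x0"
      using range_to_ac_iff by blast
    have "division3 E x0 = 0"
      using xy(2) unfolding x0 to_ac_division by simp
    moreover have False if s: "division2 E x0 = s ^ 2" for s
    proof -
      have "(2 * y + to_ac (a\<^sub>1 E * x0 + a\<^sub>3 E)) ^ 2 = to_ac s ^ 2"
        using division2_on_curve[OF xy(1)] unfolding x0 to_ac_division s sel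
        by (simp add: add.assoc)
      then have "2 * y + to_ac (a\<^sub>1 E * x0 + a\<^sub>3 E) \<in> {to_ac s, to_ac (- s)}"
        by (auto simp: power2_eq_iff)
      then obtain r where "2 * y + to_ac (a\<^sub>1 E * x0 + a\<^sub>3 E) = to_ac r"
        by blast
      then have "2 * y = to_ac (r - (a\<^sub>1 E * x0 + a\<^sub>3 E))"
        by (simp add: algebra_simps)
      then have "y = to_ac ((r - (a\<^sub>1 E * x0 + a\<^sub>3 E)) / 2)"
        using two' by (simp add: nonzero_eq_divide_eq mult.commute)
      then obtain w where "y = to_ac w"
        by blast
      then have "defined_over_base (Affine x y)"
        unfolding defined_over_base_def x0 by simp
      then show False
        using nb[of "Affine x y"] G by simp
    qed
    ultimately have "x0 \<in> nonsquare_flexes E"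
      unfolding nonsquare_flexes_def by blast
    moreover have "G = flex_subgroup E x0"
      using flex_subgroup_eq[of E x0 y] xy(1) unfolding G x0 by simp
    ultimately show "G \<in> flex_subgroup E ` nonsquare_flexes E" by blast
  next
    fix G assume "G \<in> flex_subgroup E ` nonsquare_flexes E"
    then obtain x where G: "G = flex_subgroup E x" and div3: "division3 E x = 0"
      and nsq: "\<nexists>s. division2 E x = s ^ 2"
      unfolding nonsquare_flexes_def by blast
    obtain y where on: "on_curve ?E (Affine (to_ac x) y)"
      by (rule ex_point_above)
    have G3: "G = {Infinity, Affine (to_ac x) y, neg_point ?E (Affine (to_ac x) y)}"
      unfolding G by (rule flex_subgroup_eq[OF on])
    \<comment> \<open>Zero would be a square; hence the point differs from its negative and
      \<open>G\<close> has three elements.\<close>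
    have "to_ac (division2 E x) \<noteq> 0"
      using nsq by (metis to_ac_eq_0_iff zero_power2)
    then have "2 * y + a\<^sub>1 ?E * to_ac x + a\<^sub>3 ?E \<noteq> 0"
      using division2_on_curve[OF on] unfolding to_ac_division by auto
    moreover have "division3 ?E (to_ac x) = 0"
      using div3 by (simp add: to_ac_division)
    ultimately have "subgroup G (point_group ?E) \<and> card G = 3"
      unfolding order3_subgroup_iff[OF ell'] using on G3 by blast
    moreover have "rational_set G"
      unfolding rational_set_def
    proof (rule image_subsetI)
      fix P assume "P \<in> G"
      then consider "P = Infinity" | y' where "P = Affine (to_ac x) y'" "on_curve ?E (Affine (to_ac x) y')"
        unfolding G flex_subgroup_def by blast
      then show "frobenius_point P \<in> G"
      proof cases
        case 1
        then show ?thesis by (simp add: G3 frobenius_point_def)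
      next
        case 2
        have "frobenius_point P = Affine (to_ac x) (y' ^ ?q)"
          by (simp add: 2 frobenius_point_def power_CARD_eq flip: to_ac_power)
        moreover have "G = {Infinity, Affine (to_ac x) y', neg_point ?E (Affine (to_ac x) y')}"
          unfolding G by (rule flex_subgroup_eq[OF 2(2)])
        ultimately show ?thesis
          using power_CARD_on_curve(1)[OF two 2(2)] by (auto simp: sel)
      qed
    qed
    moreover have "defined_over_quadratic_ext P \<and> \<not> defined_over_base P" if PG: "P \<in> G - {Infinity}" for P
    proof -
      obtain y' where P: "P = Affine (to_ac x) y'" and on': "on_curve ?E (Affine (to_ac x) y')"
        using PG unfolding G flex_subgroup_def by blast
      have "to_ac x ^ (?q ^ 2) = to_ac x"
        by (simp add: power2_eq_square power_mult power_CARD_eq flip: to_ac_power)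
      moreover have "y' ^ (?q ^ 2) = y'"
        using power_CARD_on_curve(2)[OF two on'] by (simp add: power2_eq_square power_mult)
      ultimately have "defined_over_quadratic_ext P"
        by (simp add: defined_over_quadratic_ext_def P)
      moreover have "\<not> defined_over_base P"
      proof
        assume "defined_over_base P"
        then obtain w where "y' = to_ac w"
          by (auto simp: defined_over_base_def P)
        then have "to_ac (division2 E x) = to_ac ((2 * w + a\<^sub>1 E * x + a\<^sub>3 E) ^ 2)"
          using division2_on_curve[OF on'] unfolding to_ac_division sel by simp
        with nsq show False
          unfolding to_ac_eq_iff by blast
      qed
      ultimately show ?thesis ..
    qed
    ultimately show "G \<in> quadratic_order3_subgroups E"
      unfolding quadratic_order3_subgroups_def geometric_group_def by blast
  }
qed

lemma card_quadratic_order3_subgroups: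
  fixes E :: "'a::{field,finite} weierstrass"
  assumes ell: "elliptic E" and two: "(2::'a) \<noteq> 0"
  shows "card (quadratic_order3_subgroups E) = card (nonsquare_flexes E)"
proof -
  have "inj (flex_subgroup E)"
  proof (rule injI)
    fix x x' assume *: "flex_subgroup E x = flex_subgroup E x'"
    obtain y where "on_curve (map_weierstrass to_ac E) (Affine (to_ac x) y)"
      by (rule ex_point_above)
    then have "Affine (to_ac x) y \<in> flex_subgroup E x"
      unfolding flex_subgroup_def by blast
    then have "Affine (to_ac x) y \<in> flex_subgroup E x'"
      unfolding * .
    then show "x = x'"
      by (auto simp: flex_subgroup_def)
  qed
  then show ?thesis
    unfolding quadratic_order3_subgroups_eq[OF assms] by (metis card_image inj_on_subset subset_UNIV)
qed

section \<open>The twisted family and the number of its classes\<close>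

theorem proposition12:
  fixes \<rho> t :: "'a::{field,finite}"
  assumes "CHAR('a) \<noteq> 2"
    and "[CARD('a) = 1] (mod 3)"
    and "\<rho> ^ 3 = 1" and "\<rho> \<noteq> 1"
    and "t \<noteq> 0" and "\<nexists>s. t = s ^ 2"
  shows
    "real (card (isomorphism_classes (four_quadratic_order3_curves :: 'a weierstrass set)))
       = (real CARD('a) + 12 - real (CARD('a) mod 12)) / 12 \<and>
     (\<forall>a \<in> UNIV - {0, \<rho> / 3, (\<rho> + 1) / 3}.
        short_weierstrass (t ^ 2 * family_A \<rho> a) (t ^ 3 * family_B \<rho> a)
          \<in> four_quadratic_order3_curves) \<and>
     (\<forall>E \<in> four_quadratic_order3_curves. \<exists>a \<in> UNIV - {0, \<rho> / 3, (\<rho> + 1) / 3}.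
        isomorphic E (short_weierstrass (t ^ 2 * family_A \<rho> a) (t ^ 3 * family_B \<rho> a)))"
proof -
  note t = \<open>\<nexists>s. t = s ^ 2\<close>
  have char_dvd: "CHAR('a) dvd CARD('a)"
    by (rule CHAR_dvd_CARD)
  have char1: "CHAR('a) \<noteq> 1"
    by (metis of_nat_1 of_nat_CHAR one_neq_zero)
  have two: "(2::'a) \<noteq> 0"
  proof
    assume "(2::'a) = 0"
    then have "CHAR('a) dvd 2"
      using of_nat_eq_0_iff_char_dvd[of 2, where 'a = 'a] by simp
    then have "CHAR('a) = 2"
      using char1 two_is_prime_nat unfolding prime_nat_iff by blast
    with assms(1) show False ..
  qed
  have three: "(3::'a) \<noteq> 0"
  proof
    assume "(3::'a) = 0"
    then have "CHAR('a) dvd 3"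
      using of_nat_eq_0_iff_char_dvd[of 3, where 'a = 'a] by simp
    moreover have "prime (3::nat)"
      by simp
    ultimately have "CHAR('a) = 3"
      using char1 unfolding prime_nat_iff by blast
    with char_dvd assms(2) show False
      by (simp add: cong_def dvd_eq_mod_eq_0)
  qed
  have rho: "\<rho> ^ 2 + \<rho> + 1 = 0"
  proof -
    have "(\<rho> - 1) * (\<rho> ^ 2 + \<rho> + 1) = \<rho> ^ 3 - 1"
      by Groebner_Basis.algebra
    with assms(3,4) show ?thesis by simp
  qed
  note ctx = rho two three
  define C where "C a = short_weierstrass (t ^ 2 * family_A \<rho> a) (t ^ 3 * family_B \<rho> a)" for a
  define four where "four = (four_quadratic_order3_curves :: 'a weierstrass set)"
  have four_iff: "E \<in> four \<longleftrightarrow> elliptic E \<and> card (nonsquare_flexes E) = 4" for E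
    unfolding four_def four_quadratic_order3_curves_def
    using card_quadratic_order3_subgroups[OF _ two, of E] by auto
  have card_twist: "card (nonsquare_flexes (short_weierstrass (t ^ 2 * A) (t ^ 3 * B))) = card (square_flexes A B)" for A B
    unfolding nonsquare_flexes_twist[OF two t] using assms(5) by (intro card_image) (simp add: inj_on_def)
  have elliptic_twist: "elliptic (short_weierstrass (t ^ 2 * A) (t ^ 3 * B)) \<longleftrightarrow> 4 * A ^ 3 + 27 * B ^ 2 \<noteq> 0" for A B
  proof -
    have "4 * (t ^ 2 * A) ^ 3 + 27 * (t ^ 3 * B) ^ 2 = t ^ 6 * (4 * A ^ 3 + 27 * B ^ 2)"
      by Groebner_Basis.algebra
    then show ?thesis
      unfolding elliptic_def discriminant_short using assms(5) numerals_nonzero[OF two three]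
      by (simp only: mult_eq_0_iff neg_equal_0_iff_equal power_eq_0_iff) simp
  qed
  have C_four: "C a \<in> four" if "a \<in> noncusps \<rho>" for a
    using that card_family_square_flexes[OF ctx that] noncusps_iff[OF ctx]
    unfolding four_iff C_def card_twist elliptic_twist by blast
  have C_complete: "\<exists>a\<in>noncusps \<rho>. isomorphic E (C a)" if "E \<in> four" for E
  proof -
    obtain A0 B0 where iso0: "isomorphic E (short_weierstrass A0 B0)"
      by (rule isomorphic_short_form[OF two three])
    \<comment> \<open>Undoing the twist turns non-square flexes into square ones, to which
      \<open>full_flexes_family\<close> applies.\<close>
    define A B where "A = A0 / t ^ 2" and "B = B0 / t ^ 3"
    have "A0 = t ^ 2 * A" "B0 = t ^ 3 * B"
      using assms(5) by (simp_all add: A_def B_def)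
    then have iso: "isomorphic E (short_weierstrass (t ^ 2 * A) (t ^ 3 * B))"
      using iso0 by simp
    then have ell: "4 * A ^ 3 + 27 * B ^ 2 \<noteq> 0" and card4: "card (square_flexes A B) = 4"
      using that isomorphic_elliptic[OF iso] isomorphic_card_nonsquare_flexes[OF iso]
      unfolding four_iff elliptic_twist card_twist by auto
    have "\<exists>x1 x2. x1 \<in> square_flexes A B \<and> x2 \<in> square_flexes A B \<and> x1 \<noteq> x2"
    proof (rule ccontr)
      assume "\<not> ?thesis"
      then have "card (square_flexes A B) \<le> Suc 0"
        by (subst card_le_Suc0_iff_eq) auto
      with card4 show False by simp
    qed
    then obtain u a where ua: "u \<noteq> 0" "a \<in> noncusps \<rho>" "A = u ^ 4 * family_A \<rho> a" "B = u ^ 6 * family_B \<rho> a"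
      using full_flexes_family[OF ctx ell] by metis
    have "isomorphic (short_weierstrass (t ^ 2 * A) (t ^ 3 * B)) (C a)"
      unfolding C_def isomorphic_short_iff[OF two three] ua(3,4) using ua(1)
      by (intro exI[of _ u]) (simp add: mult_ac)
    with iso ua(2) show ?thesis
      using isomorphic_trans by blast
  qed
  \<comment> \<open>The powers of \<open>t\<close> cancel from both sides of the rescaling
    equations.\<close>
  have C_iso: "isomorphic (C a) (C b) \<longleftrightarrow> b \<in> family_class \<rho> a" if "a \<in> noncusps \<rho>" "b \<in> noncusps \<rho>" for a b
    unfolding C_def isomorphic_short_iff[OF two three] family_class_def using that assms(5)
    by (auto simp: mult.left_commute)
  define R where "R = {(E, E' :: 'a weierstrass). isomorphic E E'}"
  have R: "equiv UNIV R"
    unfolding R_def by (rule equiv_isomorphic)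
  define f where "f a = R `` {C a}" for a
  have f_iff: "f b = f a \<longleftrightarrow> b \<in> family_class \<rho> a" if "a \<in> noncusps \<rho>" "b \<in> noncusps \<rho>" for a b
    unfolding f_def using eq_equiv_class_iff[OF R, of "C a" "C b"] C_iso[OF that] by (auto simp: R_def)
  have classes: "isomorphism_classes four = f ` noncusps \<rho>"
  proof -
    have "isomorphism_classes four = (\<lambda>E. R `` {E}) ` four"
      unfolding isomorphism_classes_def quotient_def R_def by blast
    also have "\<dots> = f ` noncusps \<rho>"
    proof (intro equalityI image_subsetI)
      fix E assume "E \<in> four"
      then obtain a where a: "a \<in> noncusps \<rho>" "isomorphic E (C a)"
        using C_complete by blast
      then have "R `` {E} = f a"
        unfolding f_def using equiv_class_eq[OF R] by (simp add: R_def)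
      with a(1) show "R `` {E} \<in> f ` noncusps \<rho>" by blast
    next
      fix a assume "a \<in> noncusps \<rho>"
      then show "f a \<in> (\<lambda>E. R `` {E}) ` four"
        unfolding f_def using C_four by blast
    qed
    finally show ?thesis .
  qed
  have "finite (UNIV :: 'a set)"
    by simp
  from card_image_family[OF ctx this f_iff]
  obtain j k where jk: "card (f ` noncusps \<rho>) = 1 + j + k" "j \<le> 1" "card (noncusps \<rho>) = 4 + 6 * j + 12 * k"
    by metis
  have "card {0, \<rho> / 3, (\<rho> + 1) / 3} = 3"
  proof -
    have "\<rho> \<noteq> 0" "\<rho> + 1 \<noteq> 0"
      using rho assms(4) by (auto simp: add_eq_0_iff2 power2_eq_square)
    then show ?thesis
      using three by simp
  qed
  then have "card (noncusps \<rho>) = CARD('a) - 3"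
    unfolding noncusps_def by (subst card_Diff_subset) auto
  with jk have q: "CARD('a) = 7 + 6 * j + 12 * k" by linarith
  have "real (card (isomorphism_classes four)) = (real CARD('a) + 12 - real (CARD('a) mod 12)) / 12"
  proof -
    \<comment> \<open>The residue of \<open>q = 7 + 6 * j + 12 * k\<close> modulo 12 is 7 for
      \<open>j = 0\<close> and 1, not 13, for \<open>j = 1\<close>; in both cases the formula
      evaluates to \<open>1 + j + k\<close>.\<close>
    have "j = 0 \<or> j = 1"
      using jk(2) by linarith
    then show ?thesis
    proof
      assume "j = 0"
      then show ?thesis
        unfolding classes jk(1) q by simp
    next
      assume "j = 1"
      moreover have "(13 + 12 * k) mod 12 = 1" by presburger
      ultimately show ?thesis
        unfolding classes jk(1) q by simp
    qed
  qed
  then show ?thesis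
    using C_four C_complete unfolding C_def four_def noncusps_def by blast
qed

end
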